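(* For a locally compact group $G$, the following conditions are equivalent: (1) $G$ is non-compact and second countable; (2) for every subset $S\subset G$ with non-compact closure there is an $S$-admissible weight $\omega$ on $G$ such that $L^p(G,\omega)$ contains $S$-dense vectors, for all (or some) $p$, $1\le p<\infty$; (3) there is a weight $\omega$ on $G$ for which all left and right translations are bounded and such that $L^p(G,\omega)$ contains $G$-dense functions, for all (or some) $p$, $1\le p<\infty$.
   Context: $G$ has a left Haar measure $\mu$. A weight on $G$ is a measurable strictly positive function $\omega$ on $G$ which is locally $p$-summable for the exponents $p$ under consideration, i.e. $\int_K\omega^p\,d\mu<\infty$ for every compact $K\subset G$. $L^p(G,\omega)$ is the space of (classes of) complex-valued measurable functions $f$ on $G$ with $\|f\|_{p,\omega}=\big(\int_G|f\omega|^p\,d\mu\big)^{1/p}<\infty$. For $s\in G$, the left translation operator is $(T_sf)(t)=f(s^{-1}t)$, $t\in G$. A weight $\omega$ is $S$-admissible if $T_s$ is bounded on $L^p(G,\omega)$ for all $s\in S$, that is, if $\|T_s\|=\operatorname{ess\,sup}_{t\in G}\omega(st)/\omega(t)<\infty$ for all $s\in S$ (this quantity does not depend on $p$). "All left and right translations are bounded" means that for every $g\in G$ the operators $f\mapsto f(g\,\cdot)$ and $f\mapsto f(\cdot\,g)$ are bounded on $L^p(G,\omega)$; equivalently, $\operatorname{ess\,sup}_{t}\omega(gt)/\omega(t)<\infty$ and $\operatorname{ess\,sup}_{t}\omega(tg)/\omega(t)<\infty$ for every $g\in G$. For $S\subset G$, a function (vector) $f\in L^p(G,\omega)$ is $S$-dense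 if its $S$-orbit $\{T_sf:s\in S\}$ is dense in $L^p(G,\omega)$; $G$-dense is the case $S=G$. The phrase "for all (or some) $p$" means that each of (2) and (3) may be read either with "for all $p$" or with "for some $p$".
   Formalization: Condition (2) is read as "G is non-compact and (2)": for compact G no subset S has non-compact closure, so (2) holds vacuously while (1) fails (e.g. the trivial group). *)

theory Defs
  imports "HOL-Analysis.Analysis"
begin

text \<open>
  Groups are elements of the class \<open>topological_group_add\<close>, whose (additively written) operation is
  \<^emph>\<open>not\<close> assumed to be commutative: \<open>s + t\<close> stands for the product $st$ and \<open>- s\<close> for $s^{-1}$.
\<close>

text \<open>
  Outer regularity is required on Borel sets and inner regularity on open sets only; beyond
  $\sigma$-compact groups a Haar measure need not be inner regular on all Borel sets.
\<close>

definition left_haar_measure :: "'a::topological_group_add measure \<Rightarrow> bool" where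
  "left_haar_measure \<mu> \<longleftrightarrow>
     sets \<mu> = sets borel \<and>
     emeasure \<mu> UNIV \<noteq> 0 \<and>
     (\<forall>K. compact K \<longrightarrow> emeasure \<mu> K < \<infinity>) \<and>
     (\<forall>A\<in>sets borel. emeasure \<mu> A = (INF U\<in>{U. open U \<and> A \<subseteq> U}. emeasure \<mu> U)) \<and>
     (\<forall>U. open U \<longrightarrow> emeasure \<mu> U = (SUP K\<in>{K. compact K \<and> K \<subseteq> U}. emeasure \<mu> K)) \<and>
     (\<forall>g. \<forall>A\<in>sets borel. emeasure \<mu> ((+) g ` A) = emeasure \<mu> A)"

definition weight :: "'a::topological_space measure \<Rightarrow> real \<Rightarrow> ('a \<Rightarrow> real) \<Rightarrow> bool" where
  "weight \<mu> p \<omega> \<longleftrightarrow>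
     \<omega> \<in> borel_measurable \<mu> \<and> (\<forall>t. 0 < \<omega> t) \<and>
     (\<forall>K. compact K \<longrightarrow> set_integrable \<mu> K (\<lambda>t. \<omega> t powr p))"

text \<open>
  Functions themselves are used instead of their classes modulo null sets, so \<open>Lp_norm\<close> is only a
  seminorm on \<open>Lp\<close>; boundedness and density are the same for it as for the quotient.
\<close>

definition Lp :: "'a measure \<Rightarrow> real \<Rightarrow> ('a \<Rightarrow> real) \<Rightarrow> ('a \<Rightarrow> complex) set" where
  "Lp \<mu> p \<omega> = {f \<in> borel_measurable \<mu>. integrable \<mu> (\<lambda>t. (cmod (f t) * \<omega> t) powr p)}"

definition Lp_norm :: "'a measure \<Rightarrow> real \<Rightarrow> ('a \<Rightarrow> real) \<Rightarrow> ('a \<Rightarrow> complex) \<Rightarrow> real" where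
  "Lp_norm \<mu> p \<omega> f = (\<integral>t. (cmod (f t) * \<omega> t) powr p \<partial>\<mu>) powr (1 / p)"

text \<open>Applied only to translations, which are linear.\<close>

definition bounded_on_Lp ::
    "'a measure \<Rightarrow> real \<Rightarrow> ('a \<Rightarrow> real) \<Rightarrow> (('a \<Rightarrow> complex) \<Rightarrow> 'a \<Rightarrow> complex) \<Rightarrow> bool" where
  "bounded_on_Lp \<mu> p \<omega> T \<longleftrightarrow>
     (\<exists>C. \<forall>f\<in>Lp \<mu> p \<omega>. T f \<in> Lp \<mu> p \<omega> \<and> Lp_norm \<mu> p \<omega> (T f) \<le> C * Lp_norm \<mu> p \<omega> f)"

definition left_translation :: "'a::group_add \<Rightarrow> ('a \<Rightarrow> complex) \<Rightarrow> 'a \<Rightarrow> complex" where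
  "left_translation s f = (\<lambda>t. f (- s + t))"

definition admissible ::
    "'a::group_add measure \<Rightarrow> real \<Rightarrow> 'a set \<Rightarrow> ('a \<Rightarrow> real) \<Rightarrow> bool" where
  "admissible \<mu> p S \<omega> \<longleftrightarrow> (\<forall>s\<in>S. bounded_on_Lp \<mu> p \<omega> (left_translation s))"

definition all_translations_bounded ::
    "'a::group_add measure \<Rightarrow> real \<Rightarrow> ('a \<Rightarrow> real) \<Rightarrow> bool" where
  "all_translations_bounded \<mu> p \<omega> \<longleftrightarrow>
     (\<forall>g. bounded_on_Lp \<mu> p \<omega> (\<lambda>f t. f (g + t)) \<and> bounded_on_Lp \<mu> p \<omega> (\<lambda>f t. f (t + g)))"

definition dense_vector ::
    "'a::group_add measure \<Rightarrow> real \<Rightarrow> ('a \<Rightarrow> real) \<Rightarrow> 'a set \<Rightarrow> ('a \<Rightarrow> complex) \<Rightarrow> bool" where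
  "dense_vector \<mu> p \<omega> S f \<longleftrightarrow>
     f \<in> Lp \<mu> p \<omega> \<and> (\<forall>s\<in>S. left_translation s f \<in> Lp \<mu> p \<omega>) \<and>
     (\<forall>g\<in>Lp \<mu> p \<omega>. \<forall>\<epsilon>>0. \<exists>s\<in>S. Lp_norm \<mu> p \<omega> (\<lambda>t. left_translation s f t - g t) < \<epsilon>)"

text \<open>
  In the four conditions below, the exponent is quantified innermost: one weight serves all
  \<open>p\<close> in the ``all'' versions, while \<open>p\<close> may depend on \<open>S\<close> and on the weight in the ``some'' versions.
  These are the strongest and the weakest readings, so the equivalence with both of them gives the
  equivalence with every reading in between, in particular with the one for a fixed \<open>p\<close>.
\<close>

definition dense_for_all_sets_all_p :: "'a::topological_group_add measure \<Rightarrow> bool" where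
  "dense_for_all_sets_all_p \<mu> \<longleftrightarrow>
     (\<forall>S. \<not> compact (closure S) \<longrightarrow>
       (\<exists>\<omega>. \<forall>p\<ge>1. weight \<mu> p \<omega> \<and> admissible \<mu> p S \<omega> \<and> (\<exists>f. dense_vector \<mu> p \<omega> S f)))"

definition dense_for_all_sets_some_p :: "'a::topological_group_add measure \<Rightarrow> bool" where
  "dense_for_all_sets_some_p \<mu> \<longleftrightarrow>
     (\<forall>S. \<not> compact (closure S) \<longrightarrow>
       (\<exists>\<omega>. \<exists>p\<ge>1. weight \<mu> p \<omega> \<and> admissible \<mu> p S \<omega> \<and> (\<exists>f. dense_vector \<mu> p \<omega> S f)))"

definition dense_for_group_all_p :: "'a::topological_group_add measure \<Rightarrow> bool" where
  "dense_for_group_all_p \<mu> \<longleftrightarrow>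
     (\<exists>\<omega>. \<forall>p\<ge>1. weight \<mu> p \<omega> \<and> all_translations_bounded \<mu> p \<omega> \<and>
       (\<exists>f. dense_vector \<mu> p \<omega> UNIV f))"

definition dense_for_group_some_p :: "'a::topological_group_add measure \<Rightarrow> bool" where
  "dense_for_group_some_p \<mu> \<longleftrightarrow>
     (\<exists>\<omega>. \<exists>p\<ge>1. weight \<mu> p \<omega> \<and> all_translations_bounded \<mu> p \<omega> \<and>
       (\<exists>f. dense_vector \<mu> p \<omega> UNIV f))"

text \<open>
  The first two conditions hold vacuously for compact groups, where no set has a non-compact
  closure. An equivalence with non-compactness must therefore exclude compact groups in them.
\<close>

end

theory Submission
  imports Defs
begin

text \<open>
The group is written additively, as in the definitions.

Sufficiency. A non-compact second countable locally compact group is exhausted by compact symmetric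
sets \<open>C n\<close> with \<open>C n + C n \<subseteq> C (n + 1)\<close>. The index of the first \<open>C n\<close> containing \<open>x\<close> is a proper
length \<open>len x\<close> that is subadditive up to a constant, in fact \<open>len (x + y) \<le> max (len x) (len y) + 1\<close>.
The weight \<open>2 powr - len x\<close> is bounded by 1, tends to 0 at infinity, and changes by at most a constant
factor under a left or right shift, whatever \<open>p\<close> is. So it is one weight for all exponents, all sets
\<open>S\<close> and all translations. For right translations one also needs \<open>\<mu> (A + g) \<le> c * \<mu> A\<close>, a weak form of the
uniqueness of Haar measure, which is proved here in \<open>haar_le_mult_haar\<close>.
A set \<open>S\<close> has non-compact closure only if \<open>len\<close> is unbounded on it. Let \<open>D k\<close> run
through a countable dense family of compactly supported functions, each repeated infinitely often, and
choose \<open>s k \<in> S\<close> with \<open>len (s k)\<close> growing very fast. The vector \<open>f = (\<Sum>k. D k (s k + _))\<close> is a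
superposition of translates with disjoint supports. Translating it by \<open>s j\<close> moves the \<open>j\<close>-th summand
back to \<open>D j\<close> and leaves all others far out, where the weight is tiny (\<open>superposition_energy\<close>).
Hence the orbit of \<open>f\<close> approximates every \<open>D j\<close>.

Necessity. Suppose that the translates \<open>f (- s + _)\<close> of some \<open>f\<close> are dense.
(a) Up to a null set \<open>f\<close> lives on a \<open>\<sigma>\<close>-compact set \<open>Q\<close>. If \<open>a\<close> lies outside the \<open>\<sigma>\<close>-compact set
\<open>K - Q + Q - K\<close>, for a compact neighbourhood \<open>K\<close> of 0, then no shift of \<open>Q\<close> meets both \<open>K\<close> and
\<open>a + K\<close>, so no translate of \<open>f\<close> is near the indicator of \<open>K \<union> (a + K)\<close>. So the group is
\<open>\<sigma>\<close>-compact.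
(b) Approximating the level sets of \<open>f\<close> by compact sets from inside and by open sets from outside
gives countably many neighbourhoods of 0 such that \<open>f (t + n) = f t\<close> almost everywhere for each \<open>n\<close> in all
of them. Left translates of \<open>f\<close> and their limits inherit this, so every function in the weighted
space has it; indicators of small open sets force \<open>n = 0\<close>. Thus 0 is a \<open>G\<^sub>\<delta>\<close> point, which in a
\<open>\<sigma>\<close>-compact locally compact group gives a countable base.
(c) On a compact group \<open>\<mu>\<close> is finite and left translations preserve the distribution of \<open>f\<close>, so one
orbit cannot approximate both constants 0 and 1.
\<close>

section \<open>Shifts in topological groups\<close>

lemma open_left_shift:
  fixes a :: "'a::topological_group_add"
  assumes "open U" shows "open ((\<lambda>x. a + x) -` U)"
  using assms by (intro open_vimage continuous_intros)

lemma open_right_shift: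
  fixes a :: "'a::topological_group_add"
  assumes "open U" shows "open ((\<lambda>x. x + a) -` U)"
  using assms by (intro open_vimage continuous_intros)

lemma image_left_shift: "(+) a ` U = (\<lambda>x. - a + x) -` U"
  for a :: "'a::group_add"
  by (auto simp: image_iff add.assoc[symmetric] intro!: bexI[of _ "- a + _"])

lemma image_right_shift: "(\<lambda>x. x + a) ` U = (\<lambda>x. x - a) -` U"
  for a :: "'a::group_add"
  by (auto simp: image_iff intro!: bexI[of _ "_ - a"])

lemma open_image_left_shift:
  fixes a :: "'a::topological_group_add"
  assumes "open U" shows "open ((+) a ` U)"
  unfolding image_left_shift by (rule open_left_shift[OF assms])

lemma compact_image_left_shift:
  fixes a :: "'a::topological_group_add"
  assumes "compact K" shows "compact ((+) a ` K)"
  using assms by (intro compact_continuous_image continuous_intros)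

lemma compact_image_right_shift:
  fixes a :: "'a::topological_group_add"
  assumes "compact K" shows "compact ((\<lambda>x. x + a) ` K)"
  using assms by (intro compact_continuous_image continuous_intros)

lemma compact_image_uminus:
  fixes K :: "'a::topological_group_add set"
  assumes "compact K" shows "compact (uminus ` K)"
  using assms by (intro compact_continuous_image continuous_intros)

lemma compact_sum_set:
  fixes A B :: "'a::topological_group_add set"
  assumes "compact A" "compact B" shows "compact ((\<lambda>(x, y). x + y) ` (A \<times> B))"
  using assms by (intro compact_continuous_image compact_Times)
    (auto simp: case_prod_unfold intro!: continuous_intros)

text \<open>
The tube lemma, applied to both \<open>k + w\<close> and \<open>w + k\<close>. It replaces uniform continuity of indicators:
a compact set stays inside a given open set under all small left and right shifts.
\<close>

lemma compact_shift_into_open: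
  fixes K :: "'a::topological_group_add set"
  assumes "compact K" "open U" "K \<subseteq> U"
  obtains W where "open W" "0 \<in> W" "\<And>w. w \<in> W \<Longrightarrow> - w \<in> W"
    "\<And>k w. k \<in> K \<Longrightarrow> w \<in> W \<Longrightarrow> k + w \<in> U" "\<And>k w. k \<in> K \<Longrightarrow> w \<in> W \<Longrightarrow> w + k \<in> U"
proof -
  have "open ((\<lambda>(w, k). k + w) -` U)" "open ((\<lambda>(w, k). w + k) -` U)"
    using assms(2) by (auto simp: case_prod_unfold intro!: open_vimage continuous_intros)
  then have op: "open ((\<lambda>(w, k). k + w) -` U \<inter> (\<lambda>(w, k). w + k) -` U)" by (rule open_Int)
  obtain X where X: "0 \<in> X" "open X"
      "X \<times> K \<subseteq> (\<lambda>(w, k). k + w) -` U \<inter> (\<lambda>(w, k). w + k) -` U"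
  proof -
    have "{0} \<times> K \<subseteq> (\<lambda>(w, k). k + w) -` U \<inter> (\<lambda>(w, k). w + k) -` U"
      using assms(3) by auto
    from Elementary_Topology.tube_lemma[OF assms(1) op this] that show thesis by metis
  qed
  have "open (uminus -` X)"
    using X(2) by (intro open_vimage continuous_intros)
  then show thesis
    using X by (intro that[of "X \<inter> uminus -` X"]) auto
qed

lemma finite_cover_by_shifts:
  fixes K W :: "'a::topological_group_add set"
  assumes "compact K" "open W" "0 \<in> W"
  obtains y and n :: nat where "K \<subseteq> (\<Union>i\<in>{0..<n}. (+) (y i) ` W)"
proof -
  have "K \<subseteq> (\<Union>x\<in>K. (+) x ` W)"
    using assms(3) by force
  then obtain Y where Y: "Y \<subseteq> K" "finite Y" "K \<subseteq> (\<Union>x\<in>Y. (+) x ` W)"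
    using compactE_image[OF assms(1), of K "\<lambda>x. (+) x ` W"] open_image_left_shift[OF assms(2)] by metis
  obtain y n where "Y = y ` {i::nat. i < n}"
    using finite_imp_nat_seg_image_inj_on[OF Y(2)] by auto
  then show thesis
    using Y(3) by (intro that[of y n]) (simp add: lessThan_def lessThan_atLeast0[symmetric])
qed

section \<open>Regularity of left Haar measures\<close>

locale haar =
  fixes \<mu> :: "'a::{topological_group_add, t2_space} measure"
  assumes lc: "locally_compact_space (euclidean :: 'a topology)"
    and left_haar: "left_haar_measure \<mu>"
begin

lemma sets_eq [simp, measurable_cong]: "sets \<mu> = sets borel"
  using left_haar by (simp add: left_haar_measure_def)

lemma space_eq [simp]: "space \<mu> = UNIV"
  using sets_eq_imp_space_eq[OF sets_eq] by simp

lemma emeasure_UNIV: "emeasure \<mu> UNIV \<noteq> 0"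
  using left_haar unfolding left_haar_measure_def by blast

lemma emeasure_compact: "compact K \<Longrightarrow> emeasure \<mu> K < \<infinity>"
  using left_haar by (simp add: left_haar_measure_def)

lemma outer_regular:
  "A \<in> sets borel \<Longrightarrow> emeasure \<mu> A = (INF U\<in>{U. open U \<and> A \<subseteq> U}. emeasure \<mu> U)"
  using left_haar by (simp add: left_haar_measure_def)

lemma inner_regular_open:
  "open U \<Longrightarrow> emeasure \<mu> U = (SUP K\<in>{K. compact K \<and> K \<subseteq> U}. emeasure \<mu> K)"
  using left_haar unfolding left_haar_measure_def by blast

lemma emeasure_left_shift:
  "A \<in> sets borel \<Longrightarrow> emeasure \<mu> ((+) g ` A) = emeasure \<mu> A"
  using left_haar by (simp add: left_haar_measure_def)

lemma emeasure_vimage_left_shift: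
  "A \<in> sets borel \<Longrightarrow> emeasure \<mu> ((\<lambda>x. g + x) -` A) = emeasure \<mu> A"
  using emeasure_left_shift[of A "- g"] unfolding image_left_shift by simp

lemma compact_nbhd:
  fixes x :: 'a
  assumes "open U" "x \<in> U"
  obtains V K where "open V" "compact K" "x \<in> V" "V \<subseteq> K" "K \<subseteq> U"
proof -
  have "Hausdorff_space (euclidean :: 'a topology)"
    unfolding Hausdorff_space_def by (auto simp: disjnt_def dest!: hausdorff)
  then have "neighbourhood_base_of (compactin euclidean) (euclidean :: 'a topology)"
    using lc locally_compact_space_neighbourhood_base[of "euclidean :: 'a topology"]
    by blast
  then have "\<forall>W x. open W \<and> x \<in> W \<longrightarrow>
      (\<exists>U V. open U \<and> compact V \<and> x \<in> U \<and> U \<subseteq> V \<and> V \<subseteq> (W :: 'a set))"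
    unfolding neighbourhood_base_of by simp
  from this[rule_format, OF conjI[OF assms]] that show thesis by metis
qed

lemma continuous_imp_measurable: "continuous_on UNIV f \<Longrightarrow> f \<in> borel_measurable \<mu>"
  by (simp add: measurable_cong_sets[OF sets_eq refl] borel_measurable_continuous_onI)

lemma left_shift_measurable [measurable]: "(+) g \<in> measurable \<mu> \<mu>"
  using continuous_imp_measurable[OF continuous_on_add[OF continuous_on_const continuous_on_id], of g]
  by (simp cong: measurable_cong_sets)

lemma borel_left_shift: "A \<in> sets borel \<Longrightarrow> (\<lambda>x::'a. g + x) -` A \<in> sets borel"
  using measurable_sets[OF borel_measurable_continuous_onI[of "\<lambda>x. g + x"], of A]
  by (auto simp: continuous_intros)

lemma borel_right_shift: "A \<in> sets borel \<Longrightarrow> (\<lambda>x::'a. x + g) -` A \<in> sets borel"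
  using measurable_sets[OF borel_measurable_continuous_onI[of "\<lambda>x. x + g"], of A]
  by (auto simp: continuous_intros)

text \<open>
If a nonempty open set were null, then every compact set, being covered by finitely many of its left
shifts, would be null, and inner regularity would make the whole group null.
\<close>

lemma emeasure_open_pos:
  assumes "open U" "x \<in> U"
  shows "emeasure \<mu> U > 0"
proof (rule ccontr)
  assume "\<not> emeasure \<mu> U > 0"
  then have U0: "emeasure \<mu> U = 0" by simp
  have "emeasure \<mu> K = 0" if K: "compact K" for K
  proof -
    have "0 \<in> (+) (- x) ` U" using assms(2) by (auto simp: image_iff intro!: bexI[of _ x])
    then obtain y and n :: nat where "K \<subseteq> (\<Union>i\<in>{0..<n}. (+) (y i) ` (+) (- x) ` U)"
      using finite_cover_by_shifts[OF K open_image_left_shift[OF assms(1)]] by metis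
    moreover have "(+) (y i) ` (+) (- x) ` U \<in> null_sets \<mu>" for i
      using assms(1) U0 open_image_left_shift[OF open_image_left_shift[OF assms(1)]]
        open_image_left_shift[OF assms(1)]
      by (intro null_setsI) (auto simp: emeasure_left_shift)
    then have "(\<Union>i\<in>{0..<n}. (+) (y i) ` (+) (- x) ` U) \<in> null_sets \<mu>"
      by (intro null_sets_UN') auto
    ultimately show ?thesis
      by (metis K compact_imp_closed borel_closed sets_eq null_sets_subset null_setsD1)
  qed
  then have "emeasure \<mu> UNIV = 0"
    by (subst inner_regular_open) (auto intro!: SUP_eq_const)
  then show False
    using left_haar by (simp add: left_haar_measure_def)
qed

lemma outer_approx:
  assumes A: "A \<in> sets borel" "emeasure \<mu> A < \<infinity>" and "0 < e"
  obtains U where "open U" "A \<subseteq> U" "emeasure \<mu> (U - A) < ennreal e"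
proof -
  have fin: "emeasure \<mu> A \<noteq> \<infinity>" using A by auto
  obtain U where U: "open U" "A \<subseteq> U" "emeasure \<mu> U < emeasure \<mu> A + e"
    using INF_approx_ennreal[OF \<open>0 < e\<close> outer_regular[OF A(1)] fin] by auto
  have "emeasure \<mu> A + emeasure \<mu> (U - A) = emeasure \<mu> U"
    using U A by (subst plus_emeasure) (auto simp: Un_absorb1 intro!: arg_cong2[where f=emeasure])
  then have "emeasure \<mu> A + emeasure \<mu> (U - A) < emeasure \<mu> A + e" using U(3) by simp
  then have "emeasure \<mu> (U - A) < e" using ennreal_add_left_cancel_less by blast
  with U show thesis by (intro that)
qed

text \<open>
Inner regularity, postulated for open sets only, passes to Borel sets of finite measure: take a large
compact part \<open>K\<close> of an open \<open>U \<supseteq> A\<close> and cut out a small open set \<open>V\<close> that covers the excess \<open>U - A\<close>.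
\<close>

lemma inner_regular:
  assumes A: "A \<in> sets borel" "emeasure \<mu> A < \<infinity>" and "e > 0"
  obtains K where "compact K" "K \<subseteq> A" "emeasure \<mu> (A - K) < ennreal e"
proof -
  define d where "d = e / 3"
  have d: "d > 0" "e = d + d + d" using \<open>e > 0\<close> by (auto simp: d_def)
  obtain U where U: "open U" "A \<subseteq> U" and UA: "emeasure \<mu> (U - A) < d"
    using outer_approx[OF A d(1)] by metis
  have Ufin: "emeasure \<mu> U \<noteq> \<infinity>"
  proof -
    have "emeasure \<mu> U \<le> emeasure \<mu> A + emeasure \<mu> (U - A)"
      using U A(1) by (intro order_trans[OF _ emeasure_subadditive] emeasure_mono) auto
    also have "\<dots> < \<infinity>" using A(2) UA by (auto intro: less_trans)
    finally show ?thesis by simp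
  qed
  obtain V where V: "open V" "U - A \<subseteq> V" "emeasure \<mu> V < d"
  proof -
    have "(INF V\<in>{V. open V \<and> U - A \<subseteq> V}. emeasure \<mu> V) < d"
      using UA U(1) A(1) outer_regular[of "U - A"] by simp
    then show thesis using that by (auto simp: INF_less_iff)
  qed
  obtain K where K: "compact K" "K \<subseteq> U" "emeasure \<mu> U < emeasure \<mu> K + d"
    using SUP_approx_ennreal[OF d(1) _ inner_regular_open[OF U(1)] Ufin] by auto
  have UK: "emeasure \<mu> (U - K) < d"
  proof -
    have Kf: "emeasure \<mu> K \<noteq> \<infinity>" using emeasure_compact[OF K(1)] by simp
    have "emeasure \<mu> K + emeasure \<mu> (U - K) = emeasure \<mu> U"
      using U K compact_imp_closed[OF K(1)]
      by (subst plus_emeasure) (auto simp: Un_absorb1 intro!: arg_cong2[where f=emeasure])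
    then have "emeasure \<mu> K + emeasure \<mu> (U - K) < emeasure \<mu> K + d" using K(3) by simp
    then show ?thesis using ennreal_add_left_cancel_less by blast
  qed
  have Kb: "K \<in> sets \<mu>" "V \<in> sets \<mu>" "U \<in> sets \<mu>"
    using compact_imp_closed[OF K(1)] V(1) U(1) by auto
  have "emeasure \<mu> (A - (K - V)) \<le> emeasure \<mu> ((U - K) \<union> V)"
    using U V K Kb by (intro emeasure_mono) auto
  also have "\<dots> \<le> emeasure \<mu> (U - K) + emeasure \<mu> V"
    using Kb by (intro emeasure_subadditive) auto
  also have "\<dots> < ennreal d + ennreal d"
    using UK V(3) by (intro add_strict_mono)
  also have "\<dots> \<le> ennreal e"
    using d by (subst ennreal_plus[symmetric]) (auto intro!: ennreal_leI)
  finally show thesis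
    using K V by (intro that[of "K - V"]) (auto intro: compact_diff)
qed

lemma inner_regular_le:
  assumes A: "A \<in> sets borel" "emeasure \<mu> A < \<infinity>"
    and le: "\<And>K. compact K \<Longrightarrow> K \<subseteq> A \<Longrightarrow> emeasure \<mu> K \<le> b"
  shows "emeasure \<mu> A \<le> b"
proof (rule ennreal_le_epsilon)
  fix e :: real assume "0 < e"
  then obtain K where K: "compact K" "K \<subseteq> A" "emeasure \<mu> (A - K) < ennreal e"
    using inner_regular[OF A] by blast
  have "emeasure \<mu> A \<le> emeasure \<mu> (K \<union> (A - K))"
    using A compact_imp_closed[OF K(1)] by (intro emeasure_mono) auto
  also have "\<dots> \<le> emeasure \<mu> K + emeasure \<mu> (A - K)"
    using A compact_imp_closed[OF K(1)] by (intro emeasure_subadditive) auto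
  also have "\<dots> \<le> b + ennreal e"
    using le[OF K(1,2)] K(3) by (intro add_mono) auto
  finally show "emeasure \<mu> A \<le> b + ennreal e" .
qed

end

section \<open>Comparison of left Haar measures\<close>

lemma ennreal_le_mult_INF:
  fixes a c :: ennreal
  assumes le: "\<And>i. i \<in> I \<Longrightarrow> a \<le> c * f i" and c: "c < \<infinity>" and ne: "I \<noteq> {}"
  shows "a \<le> c * (INF i\<in>I. f i)"
proof (cases "c = 0")
  case True
  then show ?thesis using le ne by auto
next
  case False
  have "a / c \<le> (INF i\<in>I. f i)"
    using le False by (intro INF_greatest divide_le_posI_ennreal) (auto simp: mult.commute zero_less_iff_neq_zero)
  then have "c * (a / c) \<le> c * (INF i\<in>I. f i)" by (rule mult_left_mono) simp
  moreover have "c * (a / c) = a"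
    using False c by (simp add: ennreal_times_divide ennreal_mult_divide_eq mult.commute)
  ultimately show ?thesis by simp
qed

context haar
begin

text \<open>
The idea is to measure the set of pairs \<open>(b, x)\<close> with \<open>x \<in> X\<close> and \<open>b \<in> x + K\<close> in two ways. Integrating
over \<open>b\<close> with respect to \<open>\<mu>\<close> first gives \<open>\<mu> K\<close> for each \<open>x \<in> X\<close>; for fixed \<open>b\<close>,
which lies in \<open>X + X\<close>, the point \<open>x\<close> lies in \<open>b - K\<close>, a set of measure \<open>\<nu> (- K)\<close>.
Without a countable base the set of pairs need not be measurable for the
product of the Borel \<open>\<sigma>\<close>-algebras and Fubini's theorem does not apply; instead \<open>X + X\<close> is cut into finitely
many small pieces, on each of which \<open>b - K\<close> stays in one shift of a fixed open set \<open>U \<supseteq> - K\<close>.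
\<close>

lemma haar_reflection_le:
  assumes \<nu>: "left_haar_measure \<nu>" and X: "compact X" and K: "compact K" "K \<subseteq> X"
  shows "emeasure \<mu> K * emeasure \<nu> X
    \<le> emeasure \<mu> ((\<lambda>(x, y). x + y) ` (X \<times> X)) * emeasure \<nu> (uminus ` K)"
proof -
  interpret N: haar \<nu> by unfold_locales (rule lc, rule \<nu>)
  define B where "B = (\<lambda>(x, y). x + y) ` (X \<times> X)"
  have B: "compact B" unfolding B_def by (rule compact_sum_set[OF X X])
  have bor: "B \<in> sets borel" "X \<in> sets borel" "K \<in> sets borel"
    using compact_imp_closed[OF B] compact_imp_closed[OF X] compact_imp_closed[OF K(1)] by auto
  have mK: "compact (uminus ` K)" by (rule compact_image_uminus[OF K(1)])
  have *: "emeasure \<mu> K * emeasure \<nu> X \<le> emeasure \<mu> B * emeasure \<nu> U"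
    if U: "open U" "uminus ` K \<subseteq> U" for U
  proof -
    \<comment> \<open>how small the pieces of \<open>B\<close> have to be\<close>
    obtain W where W: "open W" "0 \<in> W" "\<And>k w. k \<in> uminus ` K \<Longrightarrow> w \<in> W \<Longrightarrow> w + k \<in> U"
      using compact_shift_into_open[OF mK U] by metis
    obtain y and n :: nat where y: "B \<subseteq> (\<Union>i\<in>{0..<n}. (+) (y i) ` W)"
      using finite_cover_by_shifts[OF B W(1,2)] by metis
    define P where "P = disjointed (\<lambda>i. (+) (y i) ` W)"
    have PW: "P i \<subseteq> (+) (y i) ` W" for i unfolding P_def by (rule disjointed_subset)
    have Pb: "P i \<in> sets borel" for i
    proof -
      have "range P \<subseteq> sets borel"
        unfolding P_def using open_image_left_shift[OF W(1)]
        by (intro sets.range_disjointed_sets) auto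
      then show ?thesis by auto
    qed
    have BP: "B \<subseteq> (\<Union>i\<in>{0..<n}. P i)"
      unfolding P_def finite_UN_disjointed_eq by (rule y)
    have Pd: "disjoint_family P" unfolding P_def by (rule disjoint_family_disjointed)
    have pw: "emeasure \<mu> K * indicator X x
        \<le> (\<Sum>i\<in>{0..<n}. emeasure \<mu> (B \<inter> P i) * indicator ((+) (y i) ` U) x)" for x
    proof (cases "x \<in> X")
      case True
      have xK: "(+) x ` K \<subseteq> B" using True K(2) by (auto simp: B_def)
      have xKb: "(+) x ` K \<in> sets borel" 
        using compact_imp_closed[OF compact_image_left_shift[OF K(1)]] by auto
      have "emeasure \<mu> K = emeasure \<mu> ((+) x ` K)"
        using emeasure_left_shift[OF bor(3)] by simp
      also have "\<dots> \<le> emeasure \<mu> (\<Union>i\<in>{0..<n}. (+) x ` K \<inter> P i)"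
        using xK BP xKb Pb by (intro emeasure_mono) auto
      also have "\<dots> \<le> (\<Sum>i\<in>{0..<n}. emeasure \<mu> ((+) x ` K \<inter> P i))"
        using xKb Pb by (intro emeasure_subadditive_finite) auto
      also have "\<dots> \<le> (\<Sum>i\<in>{0..<n}. emeasure \<mu> (B \<inter> P i) * indicator ((+) (y i) ` U) x)"
      proof (rule sum_mono)
        fix i
        show "emeasure \<mu> ((+) x ` K \<inter> P i) \<le> emeasure \<mu> (B \<inter> P i) * indicator ((+) (y i) ` U) x"
        proof (cases "(+) x ` K \<inter> P i = {}")
          case False
          then obtain k w where kw: "k \<in> K" "w \<in> W" "x + k = y i + w" using PW by blast
          have "x = y i + (w + - k)"
            using kw(3) by (metis add.assoc add.right_neutral add.right_inverse)
    moreover have "w + - k \<in> U" by (rule W(3)) (use kw in auto)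
          ultimately have "x \<in> (+) (y i) ` U" by blast
          then show ?thesis using xK bor Pb by (auto intro!: emeasure_mono)
        qed simp
      qed
      finally show ?thesis using True by simp
    qed simp
    have Us: "(+) (y i) ` U \<in> sets borel" for i using open_image_left_shift[OF U(1)] by auto
    have "emeasure \<mu> K * emeasure \<nu> X = (\<integral>\<^sup>+x. emeasure \<mu> K * indicator X x \<partial>\<nu>)"
      using bor by (simp add: nn_integral_cmult_indicator)
    also have "\<dots> \<le> (\<integral>\<^sup>+x. (\<Sum>i\<in>{0..<n}. emeasure \<mu> (B \<inter> P i) * indicator ((+) (y i) ` U) x) \<partial>\<nu>)"
      by (rule nn_integral_mono) (rule pw)
    also have "\<dots> = (\<Sum>i\<in>{0..<n}. emeasure \<mu> (B \<inter> P i) * emeasure \<nu> ((+) (y i) ` U))"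
      using Us by (subst nn_integral_sum) (auto simp: nn_integral_cmult_indicator)
    also have "\<dots> = (\<Sum>i\<in>{0..<n}. emeasure \<mu> (B \<inter> P i)) * emeasure \<nu> U"
      using U(1) by (simp add: N.emeasure_left_shift sum_distrib_right)
    also have "(\<Sum>i\<in>{0..<n}. emeasure \<mu> (B \<inter> P i)) = emeasure \<mu> (\<Union>i\<in>{0..<n}. B \<inter> P i)"
      using bor Pb Pd by (intro sum_emeasure) (auto simp: disjoint_family_on_def)
    also have "(\<Union>i\<in>{0..<n}. B \<inter> P i) = B" using BP by auto
    finally show ?thesis .
  qed
  have "emeasure \<mu> K * emeasure \<nu> X
      \<le> emeasure \<mu> B * (INF U\<in>{U. open U \<and> uminus ` K \<subseteq> U}. emeasure \<nu> U)"
    using * emeasure_compact[OF B] by (intro ennreal_le_mult_INF) auto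
  also have "(INF U\<in>{U. open U \<and> uminus ` K \<subseteq> U}. emeasure \<nu> U) = emeasure \<nu> (uminus ` K)"
    using compact_imp_closed[OF mK] by (intro N.outer_regular[symmetric]) auto
  finally show ?thesis unfolding B_def .
qed

text \<open>
A weak form of the uniqueness of Haar measure. Applying \<open>haar_reflection_le\<close> twice, to \<open>K\<close> and to
\<open>- K\<close>, removes the reflection and compares \<open>\<nu> K\<close> with \<open>\<mu> K\<close> for compact \<open>K \<subseteq> X\<close>, where \<open>X\<close> is a symmetric
compact neighbourhood of 0. The constant depends on \<open>X\<close> only, so by left invariance it is the same on all
shifts of \<open>X\<close>. A disjoint decomposition carries it to all compact sets, and
regularity to all Borel sets.
\<close>

theorem haar_le_mult_haar:
  assumes \<nu>: "left_haar_measure \<nu>"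
  obtains c :: ennreal where "c < \<infinity>" "\<And>A. A \<in> sets borel \<Longrightarrow> emeasure \<nu> A \<le> c * emeasure \<mu> A"
proof -
  interpret N: haar \<nu> by unfold_locales (rule lc, rule \<nu>)
  obtain V K0 :: "'a set" where V: "open V" "compact K0" "0 \<in> V" "V \<subseteq> K0"
    using compact_nbhd[of UNIV 0] by auto
  define X where "X = K0 \<union> uminus ` K0"
  have X: "compact X" "uminus ` X = X" "V \<subseteq> X"
    using V compact_image_uminus[of K0] by (auto simp: X_def image_Un image_image)
  define B where "B = (\<lambda>(x, y). x + y) ` (X \<times> X)"
  have B: "compact B" unfolding B_def by (rule compact_sum_set[OF X(1) X(1)])
  define m where "m = emeasure \<mu> X"
  have m: "m \<noteq> 0" "m < \<infinity>"
  proof -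
    have "0 < emeasure \<mu> V" by (rule emeasure_open_pos[OF V(1,3)])
    also have "\<dots> \<le> m" unfolding m_def
      using X compact_imp_closed[OF X(1)] by (intro emeasure_mono) auto
    finally show "m \<noteq> 0" by simp
  qed (use emeasure_compact[OF X(1)] in \<open>simp add: m_def\<close>)
  define c where "c = (emeasure \<nu> B / m) * (emeasure \<mu> B / m)"
  have c: "c < \<infinity>"
    using m emeasure_compact[OF B] N.emeasure_compact[OF B]
    by (auto simp: c_def top.not_eq_extremum[symmetric] ennreal_mult_eq_top_iff ennreal_divide_eq_top_iff)
  have div: "a \<le> (b / m) * d" if "a * m \<le> b * d" for a b d
  proof -
    have "a = a * m / m" using m by (simp add: ennreal_mult_divide_eq)
    also have "\<dots> \<le> b * d / m" using that by (rule divide_right_mono_ennreal)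
    also have "\<dots> = (b / m) * d" by (simp add: ennreal_times_divide mult.commute)
    finally show ?thesis .
  qed
  have c1: "emeasure \<nu> K \<le> c * emeasure \<mu> K" if K: "compact K" "K \<subseteq> X" for K
  proof -
    have "emeasure \<nu> K \<le> (emeasure \<nu> B / m) * emeasure \<mu> (uminus ` K)"
      using N.haar_reflection_le[OF left_haar X(1) K] by (intro div) (simp add: B_def m_def)
    also have "emeasure \<mu> (uminus ` K) \<le> (emeasure \<mu> B / m) * emeasure \<mu> (uminus ` uminus ` K)"
      using haar_reflection_le[OF left_haar X(1) compact_image_uminus[OF K(1)]] K(2) X(2)
      by (intro div) (auto simp: B_def m_def)
    also have "uminus ` uminus ` K = K" by (simp add: image_image)
    finally show ?thesis by (simp add: c_def mult.assoc mult_left_mono)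
  qed
  have c2: "emeasure \<nu> A \<le> c * emeasure \<mu> A" if A: "A \<in> sets borel" "A \<subseteq> X" for A
  proof (rule N.inner_regular_le[OF A(1)])
    have "emeasure \<nu> A \<le> emeasure \<nu> X"
      using A compact_imp_closed[OF X(1)] by (intro emeasure_mono) auto
    then show "emeasure \<nu> A < \<infinity>" using N.emeasure_compact[OF X(1)] by simp
    fix K assume K: "compact K" "K \<subseteq> A"
    have "emeasure \<nu> K \<le> c * emeasure \<mu> K" using K A by (intro c1) auto
    also have "\<dots> \<le> c * emeasure \<mu> A" using K A by (intro mult_left_mono emeasure_mono) auto
    finally show "emeasure \<nu> K \<le> c * emeasure \<mu> A" .
  qed
  have c3: "emeasure \<nu> K \<le> c * emeasure \<mu> K" if K: "compact K" for K
  proof -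
    obtain y and n :: nat where y: "K \<subseteq> (\<Union>i\<in>{0..<n}. (+) (y i) ` V)"
      using finite_cover_by_shifts[OF K V(1,3)] by metis
    define P where "P = disjointed (\<lambda>i. (+) (y i) ` V)"
    have Pb: "P i \<in> sets borel" for i
    proof -
      have "range P \<subseteq> sets borel"
        unfolding P_def using open_image_left_shift[OF V(1)]
        by (intro sets.range_disjointed_sets) auto
      then show ?thesis by auto
    qed
    have Kb: "K \<in> sets borel" using compact_imp_closed[OF K] by auto
    have "K \<subseteq> (\<Union>i\<in>{0..<n}. P i)"
      unfolding P_def finite_UN_disjointed_eq by (rule y)
    then have KP: "K = (\<Union>i\<in>{0..<n}. K \<inter> P i)" by blast
    have Pd: "disjoint_family_on (\<lambda>i. K \<inter> P i) {0..<n}"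
      using disjoint_family_disjointed[of "\<lambda>i. (+) (y i) ` V"]
      unfolding P_def disjoint_family_on_def by auto
    have "emeasure \<nu> K = emeasure \<nu> (\<Union>i\<in>{0..<n}. K \<inter> P i)" using KP by simp
    also have "\<dots> = (\<Sum>i\<in>{0..<n}. emeasure \<nu> (K \<inter> P i))"
      using Kb Pb Pd by (intro sum_emeasure[symmetric]) auto
    also have "\<dots> \<le> (\<Sum>i\<in>{0..<n}. c * emeasure \<mu> (K \<inter> P i))"
    proof (rule sum_mono)
      fix i
      have KPb: "K \<inter> P i \<in> sets borel" using Kb Pb by auto
      have sh: "(\<lambda>x. y i + x) -` (K \<inter> P i) \<in> sets borel" by (rule borel_left_shift[OF KPb])
      have "P i \<subseteq> (+) (y i) ` V" unfolding P_def by (rule disjointed_subset)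
      then have "(\<lambda>x. y i + x) -` (K \<inter> P i) \<subseteq> (\<lambda>x. y i + x) -` (+) (y i) ` V" by blast
      also have "\<dots> \<subseteq> X" using X(3) by (auto simp: image_left_shift)
      finally have "(\<lambda>x. y i + x) -` (K \<inter> P i) \<subseteq> X" .
      from c2[OF sh this] show "emeasure \<nu> (K \<inter> P i) \<le> c * emeasure \<mu> (K \<inter> P i)"
        by (simp only: emeasure_vimage_left_shift[OF KPb] N.emeasure_vimage_left_shift[OF KPb])
    qed
    also have "\<dots> = c * emeasure \<mu> (\<Union>i\<in>{0..<n}. K \<inter> P i)"
      using Kb Pb Pd by (subst sum_emeasure[symmetric]) (auto simp: sum_distrib_left)
    also have "(\<Union>i\<in>{0..<n}. K \<inter> P i) = K" using KP by simp
    finally show ?thesis .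
  qed
  have c4: "emeasure \<nu> U \<le> c * emeasure \<mu> U" if U: "open U" for U
    unfolding N.inner_regular_open[OF U]
  proof (rule SUP_least)
    fix K assume "K \<in> {K. compact K \<and> K \<subseteq> U}"
    then have K: "compact K" "K \<subseteq> U" by auto
    have "emeasure \<nu> K \<le> c * emeasure \<mu> K" by (rule c3[OF K(1)])
    also have "\<dots> \<le> c * emeasure \<mu> U" using K U by (intro mult_left_mono emeasure_mono) auto
    finally show "emeasure \<nu> K \<le> c * emeasure \<mu> U" .
  qed
  have "emeasure \<nu> A \<le> c * emeasure \<mu> A" if A: "A \<in> sets borel" for A
    unfolding outer_regular[OF A]
  proof (rule ennreal_le_mult_INF[OF _ c])
    fix U assume "U \<in> {U. open U \<and> A \<subseteq> U}"
    then have U: "open U" "A \<subseteq> U" by auto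
    have "emeasure \<nu> A \<le> emeasure \<nu> U" using A U by (intro emeasure_mono) auto
    also have "\<dots> \<le> c * emeasure \<mu> U" by (rule c4[OF U(1)])
    finally show "emeasure \<nu> A \<le> c * emeasure \<mu> U" .
  qed auto
  with c show thesis by (rule that)
qed

lemma emeasure_right_shift_distr:
  "A \<in> sets borel \<Longrightarrow> emeasure (distr \<mu> borel (\<lambda>x. x + g)) A = emeasure \<mu> ((\<lambda>x. x + g) -` A)"
  by (subst emeasure_distr) (auto intro!: continuous_imp_measurable continuous_intros)

text \<open>
Left and right shifts commute and right shifts are homeomorphisms. So by \<open>haar_le_mult_haar\<close> a right
shift distorts \<open>\<mu>\<close> at most by a constant factor, which stands in for the modular function.
\<close>

lemma left_haar_right_shift: "left_haar_measure (distr \<mu> borel (\<lambda>x. x + g))"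
  unfolding left_haar_measure_def
proof (intro conjI allI impI ballI)
  let ?\<nu> = "distr \<mu> borel (\<lambda>x. x + g)"
  have eq: "(\<lambda>x. x + g) -` A = (\<lambda>x. x + - g) ` A" for A
    by (subst image_right_shift) simp
  show "sets ?\<nu> = sets borel" by simp
  show "emeasure ?\<nu> UNIV \<noteq> 0"
    using emeasure_UNIV by (simp add: emeasure_right_shift_distr)
  show "emeasure ?\<nu> K < \<infinity>" if "compact K" for K
    using emeasure_compact[OF compact_image_right_shift[OF that, of "- g"]] compact_imp_closed[OF that]
    by (simp add: emeasure_right_shift_distr eq)
  show "emeasure ?\<nu> A = (INF U\<in>{U. open U \<and> A \<subseteq> U}. emeasure ?\<nu> U)" if A: "A \<in> sets borel" for A
  proof (rule antisym)
    show "emeasure ?\<nu> A \<le> (INF U\<in>{U. open U \<and> A \<subseteq> U}. emeasure ?\<nu> U)"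
      using A by (intro INF_greatest emeasure_mono) auto
    show "(INF U\<in>{U. open U \<and> A \<subseteq> U}. emeasure ?\<nu> U) \<le> emeasure ?\<nu> A"
      unfolding emeasure_right_shift_distr[OF A] outer_regular[OF borel_right_shift[OF A]]
    proof (rule INF_greatest)
      fix U assume "U \<in> {U. open U \<and> (\<lambda>x. x + g) -` A \<subseteq> U}"
      then have U: "open U" "(\<lambda>x. x + g) -` A \<subseteq> U" by auto
      let ?U = "(\<lambda>x. x + - g) -` U"
      have "open ?U" by (rule open_right_shift[OF U(1)])
      moreover have "A \<subseteq> ?U" using U(2) by (auto simp: subset_iff)
      moreover have "(\<lambda>x. x + g) -` ?U = U" by (auto simp: add.assoc)
      ultimately show "(INF U\<in>{U. open U \<and> A \<subseteq> U}. emeasure ?\<nu> U) \<le> emeasure \<mu> U"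
        by (intro INF_lower2[of ?U]) (auto simp: emeasure_right_shift_distr)
    qed
  qed
  show "emeasure ?\<nu> U = (SUP K\<in>{K. compact K \<and> K \<subseteq> U}. emeasure ?\<nu> K)" if U: "open U" for U
  proof (rule antisym)
    show "(SUP K\<in>{K. compact K \<and> K \<subseteq> U}. emeasure ?\<nu> K) \<le> emeasure ?\<nu> U"
      using U by (intro SUP_least emeasure_mono) auto
    have Ub: "U \<in> sets borel" using U by auto
    show "emeasure ?\<nu> U \<le> (SUP K\<in>{K. compact K \<and> K \<subseteq> U}. emeasure ?\<nu> K)"
      unfolding emeasure_right_shift_distr[OF Ub] inner_regular_open[OF open_right_shift[OF U]]
    proof (rule SUP_least)
      fix K assume "K \<in> {K. compact K \<and> K \<subseteq> (\<lambda>x. x + g) -` U}"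
      then have K: "compact K" "K \<subseteq> (\<lambda>x. x + g) -` U" by auto
      let ?K = "(\<lambda>x. x + g) ` K"
      have "compact ?K" by (rule compact_image_right_shift[OF K(1)])
      moreover have "(\<lambda>x. x + g) -` ?K = K" by (auto simp: inj_on_def)
      moreover have "?K \<subseteq> U" using K(2) by auto
      ultimately show "emeasure \<mu> K \<le> (SUP K\<in>{K. compact K \<and> K \<subseteq> U}. emeasure ?\<nu> K)"
        using compact_imp_closed[of ?K]
        by (intro SUP_upper2[of ?K]) (auto simp: emeasure_right_shift_distr)
    qed
  qed
  show "emeasure ?\<nu> ((+) h ` A) = emeasure ?\<nu> A" if A: "A \<in> sets borel" for h A
  proof -
    have "(+) h ` A \<in> sets borel" unfolding image_left_shift by (rule borel_left_shift[OF A])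
    moreover have "(\<lambda>x. x + g) -` (+) h ` A = (+) h ` ((\<lambda>x. x + g) -` A)"
      unfolding image_left_shift by (auto simp: add.assoc)
    ultimately show ?thesis
      using A by (simp add: emeasure_right_shift_distr emeasure_left_shift borel_right_shift)
  qed
qed

lemma emeasure_right_shift_le:
  obtains c :: ennreal where "c < \<infinity>"
    "\<And>A. A \<in> sets borel \<Longrightarrow> emeasure \<mu> ((\<lambda>x. x + g) -` A) \<le> c * emeasure \<mu> A"
  using haar_le_mult_haar[OF left_haar_right_shift[of g]] emeasure_right_shift_distr by metis

end

section \<open>Translations on weighted spaces\<close>

context haar
begin

lemma nn_integral_left_shift:
  assumes [measurable]: "h \<in> borel_measurable \<mu>"
  shows "(\<integral>\<^sup>+t. h (g + t) \<partial>\<mu>) = (\<integral>\<^sup>+t. h t \<partial>\<mu>)"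
proof -
  have "distr \<mu> \<mu> ((+) g) = \<mu>"
    by (intro measure_eqI) (auto simp: emeasure_distr emeasure_vimage_left_shift)
  then have "(\<integral>\<^sup>+t. h t \<partial>\<mu>) = (\<integral>\<^sup>+t. h t \<partial>distr \<mu> \<mu> ((+) g))" by simp
  also have "\<dots> = (\<integral>\<^sup>+t. h (g + t) \<partial>\<mu>)" by (subst nn_integral_distr) auto
  finally show ?thesis by simp
qed

end

text \<open>
The \<open>p\<close>-th power of the weighted norm, as an extended real. This form is meaningful for every measurable
function and commutes with countable sums of disjointly supported functions.
\<close>

definition energy :: "'a measure \<Rightarrow> real \<Rightarrow> ('a \<Rightarrow> real) \<Rightarrow> ('a \<Rightarrow> complex) \<Rightarrow> ennreal" where
  "energy \<mu> p \<omega> f = (\<integral>\<^sup>+t. ennreal ((cmod (f t) * \<omega> t) powr p) \<partial>\<mu>)"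

locale weighted_haar = haar \<mu> for \<mu> :: "'a::{topological_group_add, t2_space} measure" +
  fixes p :: real and \<omega> :: "'a \<Rightarrow> real"
  assumes p: "1 \<le> p" and weight: "weight \<mu> p \<omega>"
begin

lemma weight_measurable [measurable]: "\<omega> \<in> borel_measurable \<mu>"
  and weight_pos: "0 < \<omega> t"
  using weight by (auto simp: weight_def)

lemma in_Lp_iff: "f \<in> Lp \<mu> p \<omega> \<longleftrightarrow> f \<in> borel_measurable \<mu> \<and> energy \<mu> p \<omega> f < \<infinity>"
proof (cases "f \<in> borel_measurable \<mu>")
  case True
  note [measurable] = True
  have "integrable \<mu> (\<lambda>t. (cmod (f t) * \<omega> t) powr p) \<longleftrightarrow> energy \<mu> p \<omega> f < \<infinity>"
    by (simp add: integrable_iff_bounded energy_def)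
  with True show ?thesis by (simp add: Lp_def)
qed (simp add: Lp_def)

lemma energy_eq_integral:
  assumes "f \<in> Lp \<mu> p \<omega>"
  shows "energy \<mu> p \<omega> f = ennreal (\<integral>t. (cmod (f t) * \<omega> t) powr p \<partial>\<mu>)"
  using assms by (auto simp: Lp_def energy_def intro!: nn_integral_eq_integral)

lemma Lp_norm_less_iff:
  assumes "f \<in> Lp \<mu> p \<omega>" "0 < e"
  shows "Lp_norm \<mu> p \<omega> f < e \<longleftrightarrow> energy \<mu> p \<omega> f < ennreal (e powr p)"
proof -
  define I where "I = (\<integral>t. (cmod (f t) * \<omega> t) powr p \<partial>\<mu>)"
  have I: "0 \<le> I" unfolding I_def by simp
  have "I powr (1 / p) < e \<longleftrightarrow> I < e powr p"
  proof
    assume "I powr (1 / p) < e"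
    then have "(I powr (1 / p)) powr p < e powr p"
      using p by (intro powr_less_mono2) auto
    then show "I < e powr p" using p I by (simp add: powr_powr)
  next
    assume "I < e powr p"
    then have "I powr (1 / p) < (e powr p) powr (1 / p)"
      using p I by (intro powr_less_mono2) auto
    then show "I powr (1 / p) < e" using p assms(2) by (simp add: powr_powr)
  qed
  then show ?thesis
    unfolding energy_eq_integral[OF assms(1)] Lp_norm_def I_def[symmetric]
    using I assms(2) by (simp add: ennreal_less_iff)
qed

text \<open>
A crude substitute for Minkowski's inequality, from \<open>(a + b) powr p \<le> (2 * max a b) powr p\<close>. Every use
has room for the factor \<open>2 powr p\<close>.
\<close>

lemma energy_add_le:
  assumes [measurable]: "f \<in> borel_measurable \<mu>" "g \<in> borel_measurable \<mu>"
    and le: "\<And>t. cmod (h t) \<le> cmod (f t) + cmod (g t)"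
  shows "energy \<mu> p \<omega> h \<le> ennreal (2 powr p) * (energy \<mu> p \<omega> f + energy \<mu> p \<omega> g)"
proof -
  have pw: "(c * w) powr p \<le> 2 powr p * ((a * w) powr p + (b * w) powr p)"
    if "0 \<le> a" "0 \<le> b" "0 \<le> c" "c \<le> a + b" "0 < w" for a b c w :: real
  proof -
    have "(c * w) powr p \<le> (2 * max (a * w) (b * w)) powr p"
    proof (rule powr_mono2)
      have "c * w \<le> a * w + b * w"
        using that mult_right_mono[of c "a + b" w] by (simp add: distrib_right)
      then show "c * w \<le> 2 * max (a * w) (b * w)" by linarith
    qed (use that p in auto)
    also have "\<dots> = 2 powr p * max (a * w) (b * w) powr p"
      using that by (subst powr_mult) auto
    also have "max (a * w) (b * w) powr p \<le> (a * w) powr p + (b * w) powr p"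
      by (simp add: max_def)
    finally show ?thesis by simp
  qed
  have "energy \<mu> p \<omega> h \<le> (\<integral>\<^sup>+t. ennreal (2 powr p) * (ennreal ((cmod (f t) * \<omega> t) powr p)
      + ennreal ((cmod (g t) * \<omega> t) powr p)) \<partial>\<mu>)"
    unfolding energy_def
  proof (rule nn_integral_mono)
    fix t
    have "(cmod (h t) * \<omega> t) powr p
        \<le> 2 powr p * ((cmod (f t) * \<omega> t) powr p + (cmod (g t) * \<omega> t) powr p)"
      using le[of t] weight_pos[of t] by (intro pw) auto
    then show "ennreal ((cmod (h t) * \<omega> t) powr p) \<le> ennreal (2 powr p) *
        (ennreal ((cmod (f t) * \<omega> t) powr p) + ennreal ((cmod (g t) * \<omega> t) powr p))"
      by (simp flip: ennreal_plus ennreal_mult'' add: ennreal_leI)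
  qed
  also have "\<dots> = ennreal (2 powr p) * (energy \<mu> p \<omega> f + energy \<mu> p \<omega> g)"
    unfolding energy_def by (simp add: nn_integral_cmult nn_integral_add)
  finally show ?thesis .
qed

lemma Lp_diff:
  assumes "f \<in> Lp \<mu> p \<omega>" "g \<in> Lp \<mu> p \<omega>"
  shows "(\<lambda>t. f t - g t) \<in> Lp \<mu> p \<omega>"
proof -
  have [measurable]: "f \<in> borel_measurable \<mu>" "g \<in> borel_measurable \<mu>"
    using assms by (auto simp: in_Lp_iff)
  have "energy \<mu> p \<omega> (\<lambda>t. f t - g t) \<le> ennreal (2 powr p) * (energy \<mu> p \<omega> f + energy \<mu> p \<omega> g)"
    by (intro energy_add_le) (auto simp: norm_triangle_ineq4)
  also have "\<dots> < \<infinity>"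
    using assms by (auto simp: in_Lp_iff ennreal_mult_less_top)
  finally show ?thesis by (simp add: in_Lp_iff)
qed

text \<open>
Covers left and right translations at once: for a left translation the substitution \<open>\<phi>\<close> preserves
\<open>\<mu>\<close>, for a right translation it distorts \<open>\<mu>\<close> by a bounded factor.
\<close>

lemma energy_substitution_le:
  fixes \<phi> :: "'a \<Rightarrow> 'a"
  assumes \<phi>: "continuous_on UNIV \<phi>"
    and c: "\<And>A. A \<in> sets borel \<Longrightarrow> emeasure \<mu> (\<phi> -` A) \<le> c * emeasure \<mu> A"
    and D: "\<And>t. \<omega> t \<le> D * \<omega> (\<phi> t)"
    and [measurable]: "f \<in> borel_measurable \<mu>"
  shows "energy \<mu> p \<omega> (\<lambda>t. f (\<phi> t)) \<le> ennreal (D powr p) * c * energy \<mu> p \<omega> f"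
proof -
  have [measurable]: "\<phi> \<in> measurable \<mu> borel" "\<phi> \<in> measurable \<mu> \<mu>"
    using continuous_imp_measurable[OF \<phi>] by (auto cong: measurable_cong_sets)
  have D0: "0 \<le> D" 
  proof -
    have "0 < D * \<omega> (\<phi> 0)" using weight_pos[of 0] D[of 0] by linarith
    then show ?thesis using weight_pos[of "\<phi> 0"] by (simp add: zero_less_mult_iff)
  qed
  let ?h = "\<lambda>t. ennreal ((cmod (f t) * \<omega> t) powr p)"
  have "energy \<mu> p \<omega> (\<lambda>t. f (\<phi> t)) \<le> (\<integral>\<^sup>+t. ennreal (D powr p) * ?h (\<phi> t) \<partial>\<mu>)"
    unfolding energy_def
  proof (rule nn_integral_mono)
    fix t
    have "(cmod (f (\<phi> t)) * \<omega> t) powr p \<le> (D * (cmod (f (\<phi> t)) * \<omega> (\<phi> t))) powr p"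
      using p weight_pos[of t] mult_left_mono[OF D[of t], of "cmod (f (\<phi> t))"]
      by (intro powr_mono2) (auto simp: mult_ac)
    also have "\<dots> = D powr p * (cmod (f (\<phi> t)) * \<omega> (\<phi> t)) powr p"
      using D0 weight_pos[of "\<phi> t"] by (subst powr_mult) auto
    finally show "ennreal ((cmod (f (\<phi> t)) * \<omega> t) powr p) \<le> ennreal (D powr p) * ?h (\<phi> t)"
      by (simp flip: ennreal_mult'' add: ennreal_leI)
  qed
  also have "\<dots> = ennreal (D powr p) * (\<integral>\<^sup>+t. ?h (\<phi> t) \<partial>\<mu>)"
    by (simp add: nn_integral_cmult)
  also have "(\<integral>\<^sup>+t. ?h (\<phi> t) \<partial>\<mu>) = (\<integral>\<^sup>+t. ?h t \<partial>distr \<mu> \<mu> \<phi>)"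
    by (subst nn_integral_distr) auto
  also have "\<dots> \<le> (\<integral>\<^sup>+t. ?h t \<partial>scale_measure c \<mu>)"
    by (intro nn_integral_mono_measure)
      (auto simp: le_measure emeasure_distr intro!: c)
  also have "\<dots> = c * energy \<mu> p \<omega> f"
    unfolding energy_def by (subst nn_integral_scale_measure) auto
  finally show ?thesis by (simp add: mult.assoc mult_left_mono)
qed

lemma bounded_on_LpI:
  fixes \<phi> :: "'a \<Rightarrow> 'a"
  assumes \<phi>: "continuous_on UNIV \<phi>"
    and c: "\<And>A. A \<in> sets borel \<Longrightarrow> emeasure \<mu> (\<phi> -` A) \<le> c * emeasure \<mu> A" and cfin: "c < \<infinity>"
    and D: "\<And>t. \<omega> t \<le> D * \<omega> (\<phi> t)"
  shows "bounded_on_Lp \<mu> p \<omega> (\<lambda>f t. f (\<phi> t))"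
proof -
  obtain M where M: "ennreal (D powr p) * c = ennreal M" "0 \<le> M"
  proof -
    have "ennreal (D powr p) * c < \<infinity>" using cfin by (simp add: ennreal_mult_less_top)
    then show thesis using that by (cases "ennreal (D powr p) * c") auto
  qed
  have "(\<lambda>t. f (\<phi> t)) \<in> Lp \<mu> p \<omega> \<and>
      Lp_norm \<mu> p \<omega> (\<lambda>t. f (\<phi> t)) \<le> M powr (1 / p) * Lp_norm \<mu> p \<omega> f" if f: "f \<in> Lp \<mu> p \<omega>" for f
  proof -
    have [measurable]: "f \<in> borel_measurable \<mu>" using f by (simp add: in_Lp_iff)
    have [measurable]: "\<phi> \<in> measurable \<mu> \<mu>"
      using continuous_imp_measurable[OF \<phi>] by (auto cong: measurable_cong_sets)
    have le: "energy \<mu> p \<omega> (\<lambda>t. f (\<phi> t)) \<le> ennreal M * energy \<mu> p \<omega> f"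
      using energy_substitution_le[OF \<phi> c D, of f] M by simp
    also have "\<dots> < \<infinity>" using f by (simp add: in_Lp_iff ennreal_mult_less_top)
    finally have L: "(\<lambda>t. f (\<phi> t)) \<in> Lp \<mu> p \<omega>" by (simp add: in_Lp_iff)
    define I J where "I = (\<integral>t. (cmod (f t) * \<omega> t) powr p \<partial>\<mu>)"
      and "J = (\<integral>t. (cmod (f (\<phi> t)) * \<omega> t) powr p \<partial>\<mu>)"
    have IJ: "0 \<le> I" "0 \<le> J" unfolding I_def J_def by simp_all
    have "ennreal J \<le> ennreal M * ennreal I"
      using le unfolding energy_eq_integral[OF f] energy_eq_integral[OF L] I_def J_def .
    then have "J \<le> M * I" using M IJ by (simp flip: ennreal_mult)
    then have "J powr (1 / p) \<le> (M * I) powr (1 / p)"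
      using IJ p by (intro powr_mono2) auto
    also have "\<dots> = M powr (1 / p) * I powr (1 / p)" using M IJ by (simp add: powr_mult)
    finally show ?thesis using L by (simp add: Lp_norm_def I_def J_def)
  qed
  then show ?thesis unfolding bounded_on_Lp_def by blast
qed

text \<open>
Convergence in the weighted norm gives, along a subsequence, convergence almost everywhere for
\<open>\<mu>\<close> itself because the weight is strictly positive. Second countability and
non-compactness are derived from density in this form.
\<close>

lemma dense_orbit_AE_limit:
  assumes dense: "dense_vector \<mu> p \<omega> S f" and g: "g \<in> Lp \<mu> p \<omega>"
  obtains s :: "nat \<Rightarrow> 'a" where "AE t in \<mu>. (\<lambda>k. f (- s k + t)) \<longlonglongrightarrow> g t"
proof -
  have "\<exists>s\<in>S. energy \<mu> p \<omega> (\<lambda>t. f (- s + t) - g t) < ennreal (1 / real (Suc k))" for k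
  proof -
    have "\<exists>s\<in>S. Lp_norm \<mu> p \<omega> (\<lambda>t. f (- s + t) - g t) < (1 / real (Suc k)) powr (1 / p)"
      using dense g by (auto simp: dense_vector_def left_translation_def)
    then obtain s where s: "s \<in> S"
      "Lp_norm \<mu> p \<omega> (\<lambda>t. f (- s + t) - g t) < (1 / real (Suc k)) powr (1 / p)" by blast
    have "(\<lambda>t. f (- s + t) - g t) \<in> Lp \<mu> p \<omega>"
      using dense s g by (intro Lp_diff) (auto simp: dense_vector_def left_translation_def)
    then have "energy \<mu> p \<omega> (\<lambda>t. f (- s + t) - g t) < ennreal (((1 / real (Suc k)) powr (1 / p)) powr p)"
      using s by (subst (asm) Lp_norm_less_iff) auto
    also have "((1 / real (Suc k)) powr (1 / p)) powr p = 1 / real (Suc k)"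
      using p by (simp add: powr_powr)
    finally show ?thesis using s by blast
  qed
  then obtain s where s: "\<And>k. s k \<in> S"
    "\<And>k. energy \<mu> p \<omega> (\<lambda>t. f (- s k + t) - g t) < ennreal (1 / real (Suc k))" by metis
  define u where "u k t = (cmod (f (- s k + t) - g t) * \<omega> t) powr p" for k t
  have L: "(\<lambda>t. f (- s k + t) - g t) \<in> Lp \<mu> p \<omega>" for k
    using dense s g by (intro Lp_diff) (auto simp: dense_vector_def left_translation_def)
  have int: "integrable \<mu> (u k)" for k
    using L[of k] by (simp add: Lp_def u_def[abs_def])
  have le: "(\<integral>t. u k t \<partial>\<mu>) \<le> 1 / real (Suc k)" for k
    using s(2)[of k] energy_eq_integral[OF L[of k]] by (simp add: u_def ennreal_less_iff)
  have "(\<lambda>k. \<integral>t. norm (u k t) \<partial>\<mu>) \<longlonglongrightarrow> 0"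
  proof (rule tendsto_sandwich[OF _ _ tendsto_const LIMSEQ_inverse_real_of_nat])
    show "\<forall>\<^sub>F k in sequentially. (\<integral>t. norm (u k t) \<partial>\<mu>) \<le> inverse (real (Suc k))"
      using le by (simp add: u_def inverse_eq_divide)
    show "\<forall>\<^sub>F k in sequentially. 0 \<le> (\<integral>t. norm (u k t) \<partial>\<mu>)"
      by simp
  qed
  from tendsto_L1_AE_subseq[OF int this] obtain r where
    r: "AE t in \<mu>. (\<lambda>k. u (r k) t) \<longlonglongrightarrow> 0" by blast
  have "AE t in \<mu>. (\<lambda>k. f (- s (r k) + t)) \<longlonglongrightarrow> g t"
    using r
  proof eventually_elim
    case (elim t)
    have "(\<lambda>k. u (r k) t powr (1 / p) / \<omega> t) \<longlonglongrightarrow> 0 / \<omega> t"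
      using p elim weight_pos[of t]
      by (intro tendsto_divide tendsto_zero_powrI[OF elim tendsto_const]) (auto simp: u_def)
    moreover have "u k t powr (1 / p) / \<omega> t = cmod (f (- s k + t) - g t)" for k
      using p weight_pos[of t] by (simp add: u_def powr_powr)
    ultimately have "(\<lambda>k. cmod (f (- s (r k) + t) - g t)) \<longlonglongrightarrow> 0" by simp
    then show ?case by (metis LIM_zero_cancel tendsto_norm_zero_cancel)
  qed
  then show thesis by (rule that)
qed

end

section \<open>A proper length function and its weight\<close>

text \<open>
Adding the set of all sums at each stage is what makes the resulting length subadditive up to 1, since
it forces \<open>C n + C n \<subseteq> C (n + 1)\<close>.
\<close>

primrec exhaustion :: "(nat \<Rightarrow> 'a::topological_group_add set) \<Rightarrow> nat \<Rightarrow> 'a set" where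
  "exhaustion Q 0 = {0}"
| "exhaustion Q (Suc n) =
     (\<lambda>(x, y). x + y) ` (exhaustion Q n \<times> exhaustion Q n) \<union> (Q n \<union> uminus ` Q n)"

lemma zero_in_exhaustion: "0 \<in> exhaustion Q n"
  by (induction n) force+

lemma exhaustion_add:
  "x \<in> exhaustion Q n \<Longrightarrow> y \<in> exhaustion Q n \<Longrightarrow> x + y \<in> exhaustion Q (Suc n)"
  by force

lemma exhaustion_mono: "n \<le> m \<Longrightarrow> exhaustion Q n \<subseteq> exhaustion Q m"
proof (rule lift_Suc_mono_le[of "exhaustion Q"])
  show "exhaustion Q n \<subseteq> exhaustion Q (Suc n)" for n
    using exhaustion_add[OF _ zero_in_exhaustion, of _ Q n] by auto
qed

lemma exhaustion_uminus: "x \<in> exhaustion Q n \<Longrightarrow> - x \<in> exhaustion Q n"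
proof (induction n arbitrary: x)
  case (Suc n)
  then consider a b where "a \<in> exhaustion Q n" "b \<in> exhaustion Q n" "x = a + b"
    | "x \<in> Q n" | "- x \<in> Q n" by auto
  then show ?case
  proof cases
    case 1
    then have "- b + - a \<in> exhaustion Q (Suc n)" by (intro exhaustion_add Suc.IH)
    with 1 show ?thesis by (simp add: minus_add del: exhaustion.simps)
  qed auto
qed simp

lemma compact_exhaustion: "(\<And>n. compact (Q n)) \<Longrightarrow> compact (exhaustion Q n)"
  by (induction n) (auto intro!: compact_Un compact_sum_set compact_image_uminus)

locale proper_length =
  fixes len :: "'a::topological_group_add \<Rightarrow> nat"
  assumes len_zero [simp]: "len 0 = 0"
    and len_uminus [simp]: "len (- x) = len x"
    and len_add_le: "len (x + y) \<le> max (len x) (len y) + 1"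
    and compact_len_le: "compact {x. len x \<le> n}"

context haar
begin

text \<open>
The open sets with a compact superset cover the group, and a second countable space is Lindelof.
\<close>

lemma second_countable_imp_sigma_compact:
  assumes "second_countable (euclidean :: 'a topology)"
  obtains Q :: "nat \<Rightarrow> 'a set" where "\<And>n. compact (Q n)" "(\<Union>n. Q n) = UNIV"
proof -
  let ?U = "{V :: 'a set. open V \<and> (\<exists>K. compact K \<and> V \<subseteq> K)}"
  have "\<exists>V\<in>?U. x \<in> V" for x
  proof -
    obtain V K where "open V" "compact K" "x \<in> V" "V \<subseteq> K"
      using compact_nbhd[OF open_UNIV, of x] by auto
    then show ?thesis by auto
  qed
  then have "\<Union>?U = UNIV" by blast
  then obtain \<V> where V: "countable \<V>" "\<V> \<subseteq> ?U" "\<Union>\<V> = UNIV"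
    using Lindelof_spaceD[OF second_countable_imp_Lindelof_space[OF assms], of ?U] by auto
  obtain K where K: "\<And>V. V \<in> \<V> \<Longrightarrow> compact (K V) \<and> V \<subseteq> K V"
  proof -
    have "\<forall>V\<in>\<V>. \<exists>K. compact K \<and> V \<subseteq> K" using V(2) by auto
    then show thesis using that by (auto dest!: bchoice)
  qed
  have ne: "\<V> \<noteq> {}" using V(3) by auto
  show thesis
  proof (rule that[of "\<lambda>n. K (from_nat_into \<V> n)"])
    show "compact (K (from_nat_into \<V> n))" for n
      using K from_nat_into[OF ne] by blast
    have "x \<in> (\<Union>n. K (from_nat_into \<V> n))" for x
    proof -
      have "x \<in> \<Union>\<V>" unfolding V(3) by simp
      then obtain V where "V \<in> \<V>" "x \<in> V" by (rule UnionE)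
      then have "x \<in> K (from_nat_into \<V> (to_nat_on \<V> V))"
        using K[of V] from_nat_into_to_nat_on[OF V(1), of V] by auto
      then show ?thesis by blast
    qed
    then show "(\<Union>n. K (from_nat_into \<V> n)) = UNIV" by blast
  qed
qed

lemma ex_proper_length:
  assumes "second_countable (euclidean :: 'a topology)"
  obtains len :: "'a \<Rightarrow> nat" where "proper_length len"
proof -
  obtain Q :: "nat \<Rightarrow> 'a set" where Q: "\<And>n. compact (Q n)" "(\<Union>n. Q n) = UNIV"
    using second_countable_imp_sigma_compact[OF assms] by metis
  define C where "C = exhaustion Q"
  define len where "len x = (LEAST n. x \<in> C n)" for x
  have "\<exists>n. x \<in> C n" for x
  proof -
    obtain n where "x \<in> Q n" using Q(2) by blast
    then have "x \<in> C (Suc n)" by (simp add: C_def)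
    then show ?thesis ..
  qed
  then have C: "x \<in> C (len x)" for x
    unfolding len_def by (metis LeastI)
  have len_le: "len x \<le> n \<longleftrightarrow> x \<in> C n" for x n
  proof
    show "len x \<le> n \<Longrightarrow> x \<in> C n"
      using C[of x] exhaustion_mono[of "len x" n Q] by (auto simp: C_def)
    show "x \<in> C n \<Longrightarrow> len x \<le> n" unfolding len_def by (rule Least_le)
  qed
  have "proper_length len"
  proof
    show "len 0 = 0" using len_le[of 0 0] by (simp add: C_def)
    have le: "len (- x) \<le> len x" for x
      unfolding len_le using C[of x] exhaustion_uminus by (simp add: C_def)
    show "len (- x) = len x" for x
      using le[of x] le[of "- x"] by simp
    show "len (x + y) \<le> max (len x) (len y) + 1" for x y
    proof -
      have "x \<in> C (max (len x) (len y))" "y \<in> C (max (len x) (len y))"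
        by (simp_all flip: len_le)
      then have "x + y \<in> C (Suc (max (len x) (len y)))"
        unfolding C_def by (rule exhaustion_add)
      then show ?thesis by (simp flip: len_le)
    qed
    show "compact {x. len x \<le> n}" for n
      unfolding len_le C_def using compact_exhaustion[of Q, OF Q(1)] by simp
  qed
  then show thesis by (rule that)
qed

end

locale haar_length = haar \<mu> + proper_length len
  for \<mu> :: "'a::{topological_group_add, t2_space} measure" and len :: "'a \<Rightarrow> nat"
begin

text \<open>
Any decreasing positive function of the length that loses only a bounded factor per step would do. The
geometric one bounds the distortion under a shift by \<open>g\<close> by \<open>2 ^ (len g + 1)\<close>.
\<close>

definition wt :: "'a \<Rightarrow> real" where
  "wt t = (1 / 2) ^ len t"

lemma closed_len_le: "closed {x. len x \<le> n}"
  by (rule compact_imp_closed[OF compact_len_le])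

lemma len_le_borel [measurable]: "{x. len x \<le> n} \<in> sets borel"
  using closed_len_le by auto

lemma len_measurable [measurable]: "len \<in> measurable \<mu> (count_space UNIV)"
proof -
  have "len -` {n} \<in> sets borel" for n
  proof (cases n)
    case 0
    then have "len -` {n} = {x. len x \<le> 0}" by auto
    then show ?thesis using len_le_borel[of 0] by metis
  next
    case (Suc m)
    then have "len -` {n} = {x. len x \<le> Suc m} - {x. len x \<le> m}" by auto
    then show ?thesis by simp
  qed
  then show ?thesis by (subst measurable_count_space_eq2_countable) auto
qed

lemma wt_measurable [measurable]: "wt \<in> borel_measurable \<mu>"
  unfolding wt_def by measurable

lemma wt_pos: "0 < wt t" and wt_le_one: "wt t \<le> 1"
  unfolding wt_def by (auto intro: power_le_one)

lemma emeasure_len_le: "emeasure \<mu> {x. len x \<le> n} < \<infinity>"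
  by (rule emeasure_compact[OF compact_len_le])

lemma weight_wt:
  assumes "1 \<le> p" shows "weight \<mu> p wt"
  unfolding weight_def
proof (intro conjI allI impI wt_pos wt_measurable)
  fix K :: "'a set" assume K: "compact K"
  have "wt t powr p \<le> 1" for t
    using wt_pos[of t] wt_le_one[of t] assms powr_mono2[of p "wt t" 1] by simp
  then show "set_integrable \<mu> K (\<lambda>t. wt t powr p)"
    unfolding set_integrable_def
    using compact_imp_closed[OF K] emeasure_compact[OF K]
    by (intro integrableI_bounded_set_indicator[where B=1]) auto
qed

lemma wt_le:
  assumes "len y \<le> len x + m" shows "wt x \<le> 2 ^ m * wt y"
proof -
  have "wt x = 2 ^ m * (1 / 2) ^ (len x + m)"
    by (simp add: wt_def power_add power_one_over)
  also have "\<dots> \<le> 2 ^ m * wt y"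
    unfolding wt_def using assms by (intro mult_left_mono power_decreasing) auto
  finally show ?thesis .
qed

lemma bounded_left_wt:
  assumes "1 \<le> p" shows "bounded_on_Lp \<mu> p wt (\<lambda>f t. f (g + t))"
proof -
  interpret weighted_haar \<mu> p wt by unfold_locales (use assms weight_wt in auto)
  show ?thesis
  proof (rule bounded_on_LpI[where c = 1])
    show "wt t \<le> 2 ^ (len g + 1) * wt (g + t)" for t
      using len_add_le[of g t] by (intro wt_le) auto
  qed (auto simp: emeasure_vimage_left_shift intro!: continuous_intros)
qed

lemma bounded_right_wt:
  assumes "1 \<le> p" shows "bounded_on_Lp \<mu> p wt (\<lambda>f t. f (t + g))"
proof -
  interpret weighted_haar \<mu> p wt by unfold_locales (use assms weight_wt in auto)
  obtain c :: ennreal where c: "c < \<infinity>"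
    "\<And>A. A \<in> sets borel \<Longrightarrow> emeasure \<mu> ((\<lambda>x. x + g) -` A) \<le> c * emeasure \<mu> A"
    using emeasure_right_shift_le[of g] by metis
  show ?thesis
  proof (rule bounded_on_LpI[OF _ c(2,1)])
    show "wt t \<le> 2 ^ (len g + 1) * wt (t + g)" for t
      using len_add_le[of t g] by (intro wt_le) auto
  qed (auto intro!: continuous_intros)
qed

end

section \<open>A countable dense family of compactly supported functions\<close>

context haar_length
begin

lemma energy_wt_le:
  assumes "1 \<le> p" and A: "A \<in> sets borel" and h: "\<And>t. cmod (h t) \<le> M * indicator A t" and M: "0 \<le> M"
  shows "energy \<mu> p wt h \<le> ennreal (M powr p) * emeasure \<mu> A"
proof -
  have "energy \<mu> p wt h \<le> (\<integral>\<^sup>+t. ennreal (M powr p) * indicator A t \<partial>\<mu>)"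
    unfolding energy_def
  proof (rule nn_integral_mono)
    fix t
    have "cmod (h t) * wt t \<le> M * indicator A t"
      using h[of t] wt_le_one[of t] wt_pos[of t] mult_mono[of "cmod (h t)" "M * indicator A t" "wt t" 1]
      by (smt (verit, best) norm_ge_zero mult.right_neutral)
    then have "(cmod (h t) * wt t) powr p \<le> (M * indicator A t) powr p"
      using assms(1) wt_pos[of t] by (intro powr_mono2) auto
    then show "ennreal ((cmod (h t) * wt t) powr p) \<le> ennreal (M powr p) * indicator A t"
      by (auto simp: indicator_def intro: ennreal_leI split: if_splits)
  qed
  also have "\<dots> = ennreal (M powr p) * emeasure \<mu> A"
    using A by (simp add: nn_integral_cmult_indicator)
  finally show ?thesis .
qed

text \<open>
Step functions over the triples \<open>(i, j, n)\<close> of a finite list: coefficient \<open>c i\<close> on the part of \<open>E j\<close> of length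
at most \<open>n\<close>. Indexing by lists makes the family visibly countable and turns sums into
concatenation.
\<close>

definition step :: "(nat \<Rightarrow> 'a set) \<Rightarrow> (nat \<Rightarrow> complex) \<Rightarrow> (nat \<times> nat \<times> nat) list \<Rightarrow> 'a \<Rightarrow> complex" where
  "step E c xs t = (\<Sum>(i, j, n)\<leftarrow>xs. c i * indicator (E j \<inter> {x. len x \<le> n}) t)"

lemma step_append: "step E c (xs @ ys) t = step E c xs t + step E c ys t"
  by (simp add: step_def)

lemma step_Nil [simp]: "step E c [] t = 0"
  by (simp add: step_def)

lemma step_Cons:
  "step E c ((i, j, n) # xs) t = c i * indicator (E j \<inter> {x. len x \<le> n}) t + step E c xs t"
  by (simp add: step_def)

lemma step_bounded: "\<exists>r M. \<forall>t. cmod (step E c xs t) \<le> M * indicator {x. len x \<le> r} t"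
proof (induction xs)
  case Nil
  show ?case by (intro exI[of _ 0]) auto
next
  case (Cons x xs)
  obtain i j n where x: "x = (i, j, n)" by (cases x)
  obtain r M where rM: "\<And>t. cmod (step E c xs t) \<le> M * indicator {x. len x \<le> r} t"
    using Cons by blast
  have "cmod (step E c (x # xs) t) \<le> (cmod (c i) + \<bar>M\<bar>) * indicator {x. len x \<le> max n r} t" for t
  proof -
    have "cmod (step E c (x # xs) t)
        \<le> cmod (c i * indicator (E j \<inter> {x. len x \<le> n}) t) + cmod (step E c xs t)"
      unfolding x step_Cons by (rule norm_triangle_ineq)
    also have "\<dots> \<le> cmod (c i) * indicator {x. len x \<le> max n r} t
        + \<bar>M\<bar> * indicator {x. len x \<le> max n r} t"
    proof (rule add_mono)
      show "cmod (c i * indicator (E j \<inter> {x. len x \<le> n}) t) \<le> cmod (c i) * indicator {x. len x \<le> max n r} t"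
        by (auto simp: indicator_def norm_mult)
      show "cmod (step E c xs t) \<le> \<bar>M\<bar> * indicator {x. len x \<le> max n r} t"
        using rM[of t] by (cases "len t \<le> r") auto
    qed
    finally show ?thesis by (simp add: distrib_right)
  qed
  then show ?case by blast
qed

lemma step_measurable:
  assumes "\<And>j. open (E j)" shows "step E c xs \<in> borel_measurable \<mu>"
proof (induction xs)
  case Nil
  have "step E c [] = (\<lambda>t. 0)" by (rule ext) simp
  then show ?case by simp
next
  case (Cons x xs)
  obtain i j n where x: "x = (i, j, n)" by (cases x)
  note [measurable] = Cons
  have [measurable]: "E j \<in> sets borel" using assms by auto
  have "step E c (x # xs) = (\<lambda>t. c i * indicator (E j \<inter> {x. len x \<le> n}) t + step E c xs t)"
    by (rule ext) (simp add: x step_Cons)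
  then show ?case by simp
qed

text \<open>
Bookkeeping for \<open>energy_add_le\<close>: with \<open>A = 2 powr p\<close>, two errors of at most \<open>e / (4 * A)\<close> leave a total
strictly below \<open>e\<close>.
\<close>

lemma ennreal_scaled_lt:
  fixes A e :: real and x y :: ennreal
  assumes "0 < A" "0 < e" "x \<le> ennreal (e / (4 * A))" "y \<le> ennreal (e / (4 * A))"
  shows "ennreal A * (x + y) < ennreal e"
proof -
  have "ennreal A * (x + y) \<le> ennreal A * (ennreal (e / (4 * A)) + ennreal (e / (4 * A)))"
    using assms by (intro mult_left_mono add_mono) auto
  also have "\<dots> = ennreal (e / 2)"
    using assms by (simp flip: ennreal_plus ennreal_mult add: field_simps)
  also have "\<dots> < ennreal e" using assms by (simp add: ennreal_lessI)
  finally show ?thesis .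
qed

text \<open>
The functions that can be approximated form a class closed under sums and limits. It contains the
multiples of indicators of bounded Borel sets: by regularity such a set and its
complement contain compact sets with small remainders, and the basis property yields an \<open>E j\<close> that
contains the first and avoids the second.
Hence the class contains all simple functions cut off at bounded length, and these tend to \<open>g\<close> by dominated
convergence.
\<close>

lemma approx_by_step:
  assumes p: "1 \<le> p" and E: "\<And>j. open (E j)"
    and E_basis: "\<And>K U. compact K \<Longrightarrow> open U \<Longrightarrow> K \<subseteq> U \<Longrightarrow> \<exists>j. K \<subseteq> E j \<and> E j \<subseteq> U"
    and c: "\<And>z e. 0 < e \<Longrightarrow> \<exists>i. cmod (z - c i) < e"
    and g: "g \<in> Lp \<mu> p wt" and e: "0 < e"
  shows "\<exists>xs. energy \<mu> p wt (\<lambda>t. g t - step E c xs t) < ennreal e"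
proof -
  interpret weighted_haar \<mu> p wt by unfold_locales (use p weight_wt in auto)
  define P where "P = (2 :: real) powr p"
  have P: "0 < P" by (simp add: P_def)
  note [measurable] = step_measurable[OF E]
  define approx where "approx g \<longleftrightarrow> g \<in> borel_measurable \<mu> \<and>
      (\<forall>e>0. \<exists>xs. energy \<mu> p wt (\<lambda>t. g t - step E c xs t) < ennreal e)" for g
  have approx_limit: "approx g" if g: "g \<in> borel_measurable \<mu>"
    and h: "\<And>e. 0 < e \<Longrightarrow> \<exists>h. approx h \<and> energy \<mu> p wt (\<lambda>t. g t - h t) < ennreal e" for g
    unfolding approx_def
  proof (intro conjI allI impI g)
    fix e :: real assume e: "0 < e"
    then have e4: "0 < e / (4 * P)" using P by simp
    obtain h where h: "approx h" "energy \<mu> p wt (\<lambda>t. g t - h t) < ennreal (e / (4 * P))"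
      using h[OF e4] by blast
    obtain xs where xs: "energy \<mu> p wt (\<lambda>t. h t - step E c xs t) < ennreal (e / (4 * P))"
      using h(1) e4 unfolding approx_def by blast
    have [measurable]: "h \<in> borel_measurable \<mu>" using h(1) by (simp add: approx_def)
    have "energy \<mu> p wt (\<lambda>t. g t - step E c xs t)
        \<le> ennreal P * (energy \<mu> p wt (\<lambda>t. g t - h t) + energy \<mu> p wt (\<lambda>t. h t - step E c xs t))"
      unfolding P_def using g by (intro energy_add_le) (auto intro: norm_diff_triangle_le[OF order_refl order_refl])
    also have "\<dots> < ennreal e" using h(2) xs by (intro ennreal_scaled_lt P e) auto
    finally show "\<exists>xs. energy \<mu> p wt (\<lambda>t. g t - step E c xs t) < ennreal e" ..
  qed
  have approx_add: "approx (\<lambda>t. f t + g t)" if f: "approx f" and g: "approx g" for f g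
    unfolding approx_def
  proof (intro conjI allI impI)
    have [measurable]: "f \<in> borel_measurable \<mu>" "g \<in> borel_measurable \<mu>"
      using f g by (auto simp: approx_def)
    show "(\<lambda>t. f t + g t) \<in> borel_measurable \<mu>" by simp
    fix e :: real assume e: "0 < e"
    then have e4: "0 < e / (4 * P)" using P by simp
    obtain xs ys where xs: "energy \<mu> p wt (\<lambda>t. f t - step E c xs t) < ennreal (e / (4 * P))"
      and ys: "energy \<mu> p wt (\<lambda>t. g t - step E c ys t) < ennreal (e / (4 * P))"
      using f g e4 unfolding approx_def by meson
    have "energy \<mu> p wt (\<lambda>t. f t + g t - step E c (xs @ ys) t)
        \<le> ennreal P * (energy \<mu> p wt (\<lambda>t. f t - step E c xs t) + energy \<mu> p wt (\<lambda>t. g t - step E c ys t))"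
      unfolding P_def step_append
      by (intro energy_add_le) (auto simp: norm_diff_triangle_ineq)
    also have "\<dots> < ennreal e" using xs ys by (intro ennreal_scaled_lt P e) auto
    finally show "\<exists>xs. energy \<mu> p wt (\<lambda>t. f t + g t - step E c xs t) < ennreal e" ..
  qed
  have approx_indicator: "approx (\<lambda>t. y * indicator B t)"
    if B: "B \<in> sets borel" "B \<subseteq> {x. len x \<le> n}" for y B n
    unfolding approx_def
  proof (intro conjI allI impI)
    note [measurable] = B(1)
    show "(\<lambda>t. y * indicator B t) \<in> borel_measurable \<mu>" by simp
    fix e :: real assume e: "0 < e"
    define d where "d = e / (4 * P)"
    have d: "0 < d" using P e by (simp add: d_def)
    let ?C = "{x. len x \<le> n}"
    obtain m where m: "emeasure \<mu> ?C = ennreal m" "0 \<le> m"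
      using emeasure_len_le[of n] by (cases "emeasure \<mu> ?C") auto
    obtain i where i: "cmod (y - c i) < (d / (m + 1)) powr (1 / p)"
      using c[of "(d / (m + 1)) powr (1 / p)"] d m by auto
    define M where "M = cmod (c i) powr p"
    have M: "0 \<le> M" by (simp add: M_def)
    define \<delta> where "\<delta> = d / (M + 1) / 2"
    have \<delta>: "0 < \<delta>" using d M by (simp add: \<delta>_def)
    have fin: "emeasure \<mu> B < \<infinity>" "emeasure \<mu> (?C - B) < \<infinity>"
    proof -
      have "emeasure \<mu> B \<le> emeasure \<mu> ?C" using B by (intro emeasure_mono) auto
      then show "emeasure \<mu> B < \<infinity>" using emeasure_len_le[of n] by simp
      have "emeasure \<mu> (?C - B) \<le> emeasure \<mu> ?C" using B by (intro emeasure_mono) auto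
      then show "emeasure \<mu> (?C - B) < \<infinity>" using emeasure_len_le[of n] by simp
    qed
    \<comment> \<open>inside \<open>?C\<close>, a set between \<open>K\<close> and \<open>- L\<close> differs from \<open>B\<close> only by the two remainders\<close>
    obtain K where K: "compact K" "K \<subseteq> B" "emeasure \<mu> (B - K) < ennreal \<delta>"
      using inner_regular[OF B(1) fin(1) \<delta>] by blast
    have CB: "?C - B \<in> sets borel" by measurable
    obtain L where L: "compact L" "L \<subseteq> ?C - B" "emeasure \<mu> (?C - B - L) < ennreal \<delta>"
      using inner_regular[OF CB fin(2) \<delta>] by blast
    have [measurable]: "K \<in> sets borel" "L \<in> sets borel"
      using compact_imp_closed[OF K(1)] compact_imp_closed[OF L(1)] by auto
    obtain j where j: "K \<subseteq> E j" "E j \<subseteq> - L"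
      using E_basis[of K "- L"] K L compact_imp_closed[OF L(1)] by (auto simp: open_Compl)
    let ?D = "(B - K) \<union> (?C - B - L)"
    have "emeasure \<mu> ?D \<le> emeasure \<mu> (B - K) + emeasure \<mu> (?C - B - L)"
      by (intro emeasure_subadditive) auto
    also have "\<dots> \<le> ennreal \<delta> + ennreal \<delta>" using K(3) L(3) by (intro add_mono) auto
    also have "\<dots> = ennreal (\<delta> + \<delta>)" using \<delta> by (simp flip: ennreal_plus)
    also have "\<delta> + \<delta> = d / (M + 1)" unfolding \<delta>_def by (rule field_sum_of_halves)
    finally have D: "emeasure \<mu> ?D \<le> ennreal (d / (M + 1))" .
    have [measurable]: "E j \<in> sets borel" using E by auto
    have "energy \<mu> p wt (\<lambda>t. y * indicator B t - step E c [(i, j, n)] t)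
        \<le> ennreal P * (energy \<mu> p wt (\<lambda>t. (y - c i) * indicator B t)
          + energy \<mu> p wt (\<lambda>t. c i * (indicator B t - indicator (E j \<inter> ?C) t)))"
      unfolding P_def
    proof (intro energy_add_le)
      fix t
      have "y * indicator B t - step E c [(i, j, n)] t
          = (y - c i) * indicator B t + c i * (indicator B t - indicator (E j \<inter> ?C) t)"
        by (simp add: step_Cons algebra_simps)
      then show "cmod (y * indicator B t - step E c [(i, j, n)] t)
          \<le> cmod ((y - c i) * indicator B t) + cmod (c i * (indicator B t - indicator (E j \<inter> ?C) t))"
        using norm_triangle_ineq by metis
    qed auto
    also have "\<dots> < ennreal e"
    proof (intro ennreal_scaled_lt P e)
      have "energy \<mu> p wt (\<lambda>t. (y - c i) * indicator B t)
          \<le> ennreal (cmod (y - c i) powr p) * emeasure \<mu> ?C"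
        using B p by (intro energy_wt_le) (auto simp: norm_mult indicator_def)
      also have "\<dots> = ennreal (cmod (y - c i) powr p * m)" using m by (simp add: ennreal_mult)
      also have "\<dots> \<le> ennreal d"
      proof (rule ennreal_leI)
        have "cmod (y - c i) powr p \<le> ((d / (m + 1)) powr (1 / p)) powr p"
          using i p by (intro powr_mono2) auto
        also have "\<dots> = d / (m + 1)" using p d m by (simp add: powr_powr)
        finally have "cmod (y - c i) powr p * m \<le> d / (m + 1) * m"
          using m by (intro mult_right_mono) auto
        also have "\<dots> \<le> d" using d m by (simp add: field_simps)
        finally show "cmod (y - c i) powr p * m \<le> d" .
      qed
      finally show "energy \<mu> p wt (\<lambda>t. (y - c i) * indicator B t) \<le> ennreal (e / (4 * P))"
        by (simp add: d_def)
      have "energy \<mu> p wt (\<lambda>t. c i * (indicator B t - indicator (E j \<inter> ?C) t))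
          \<le> ennreal M * emeasure \<mu> ?D"
        unfolding M_def using B j p
        by (intro energy_wt_le) (auto simp: norm_mult indicator_def split: if_splits)
      also have "\<dots> \<le> ennreal M * ennreal (d / (M + 1))" using D by (intro mult_left_mono) auto
      also have "\<dots> = ennreal (M * (d / (M + 1)))"
        using M d by (intro ennreal_mult[symmetric]) auto
      also have "\<dots> \<le> ennreal d" using M d by (intro ennreal_leI) (simp add: field_simps)
      finally show "energy \<mu> p wt (\<lambda>t. c i * (indicator B t - indicator (E j \<inter> ?C) t))
          \<le> ennreal (e / (4 * P))" by (simp add: d_def)
    qed
    finally show "\<exists>xs. energy \<mu> p wt (\<lambda>t. y * indicator B t - step E c xs t) < ennreal e" ..
  qed
  have approx_sum: "approx (\<lambda>t. \<Sum>y\<in>Y. h y t)" if "finite Y" "\<And>y. y \<in> Y \<Longrightarrow> approx (h y)"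
    for h and Y :: "complex set"
    using that
  proof (induction Y rule: finite_induct)
    case empty
    show ?case using approx_indicator[of "{}" 0 0] by simp
  next
    case (insert y Y)
    then show ?case using approx_add[of "h y" "\<lambda>t. \<Sum>y\<in>Y. h y t"] by simp
  qed
  have approx_simple: "approx (\<lambda>t. F t * indicator {x. len x \<le> n} t)" if F: "simple_function \<mu> F" for F n
  proof -
    have fin: "finite (range F)" using simple_functionD(1)[OF F] by simp
    have "approx (\<lambda>t. \<Sum>y\<in>range F. y * indicator (F -` {y} \<inter> {x. len x \<le> n}) t)"
    proof (rule approx_sum[OF fin])
      fix y
      have "F -` {y} \<in> sets borel" using simple_functionD(2)[OF F, of "{y}"] by simp
      then show "approx (\<lambda>t. y * indicator (F -` {y} \<inter> {x. len x \<le> n}) t)"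
        by (intro approx_indicator[of _ n]) auto
    qed
    moreover have "(\<Sum>y\<in>range F. y * indicator (F -` {y} \<inter> {x. len x \<le> n}) t)
        = F t * indicator {x. len x \<le> n} t" for t
    proof -
      have "(\<Sum>y\<in>range F. y * indicator (F -` {y} \<inter> {x. len x \<le> n}) t)
          = (\<Sum>y\<in>range F. if y = F t then F t * indicator {x. len x \<le> n} t else 0)"
        by (intro sum.cong) (auto simp: indicator_def)
      then show ?thesis using fin by simp
    qed
    ultimately show ?thesis by simp
  qed
  have [measurable]: "g \<in> borel_measurable \<mu>" using g by (simp add: in_Lp_iff)
  obtain F where F: "\<And>i. simple_function \<mu> (F i)" "\<And>x. (\<lambda>i. F i x) \<longlonglongrightarrow> g x"
      "\<And>i x. cmod (F i x) \<le> 2 * cmod (g x)"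
    using borel_measurable_implies_sequence_metric[of g \<mu> 0] by (auto simp: dist_norm)
  note [measurable] = borel_measurable_simple_function[OF F(1)]
  \<comment> \<open>the cut-off at length \<open>i\<close> makes the level sets bounded without spoiling pointwise convergence\<close>
  define G where "G i t = F i t * indicator {x. len x \<le> i} t" for i t
  have [measurable]: "G i \<in> borel_measurable \<mu>" for i unfolding G_def[abs_def] by measurable
  have Glim: "(\<lambda>i. G i x) \<longlonglongrightarrow> g x" for x
  proof -
    have "\<forall>\<^sub>F i in sequentially. G i x = F i x"
      using eventually_ge_at_top[of "len x"] by eventually_elim (simp add: G_def)
    then show ?thesis using F(2)[of x] by (simp add: tendsto_cong)
  qed
  have Gle: "cmod (g x - G i x) \<le> 3 * cmod (g x)" for i x
  proof -
    have "cmod (G i x) \<le> 2 * cmod (g x)" using F(3)[of i x] by (simp add: G_def indicator_def)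
    then show ?thesis using norm_triangle_ineq4[of "g x" "G i x"] by linarith
  qed
  have "(\<lambda>i. \<integral>\<^sup>+t. ennreal ((cmod (g t - G i t) * wt t) powr p) \<partial>\<mu>) \<longlonglongrightarrow> (\<integral>\<^sup>+t. 0 \<partial>\<mu>)"
  proof (rule nn_integral_dominated_convergence[where w = "\<lambda>t. ennreal (3 powr p) * ennreal ((cmod (g t) * wt t) powr p)"])
    show "AE t in \<mu>. ennreal ((cmod (g t - G j t) * wt t) powr p)
        \<le> ennreal (3 powr p) * ennreal ((cmod (g t) * wt t) powr p)" for j
    proof (rule AE_I2)
      fix t
      have "(cmod (g t - G j t) * wt t) powr p \<le> (3 * (cmod (g t) * wt t)) powr p"
        using Gle[of t j] wt_pos[of t] p mult_right_mono[OF Gle[of t j], of "wt t"]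
        by (intro powr_mono2) (auto simp: mult.assoc)
      also have "\<dots> = 3 powr p * (cmod (g t) * wt t) powr p"
        using wt_pos[of t] by (subst powr_mult) auto
      finally show "ennreal ((cmod (g t - G j t) * wt t) powr p)
          \<le> ennreal (3 powr p) * ennreal ((cmod (g t) * wt t) powr p)"
        by (simp flip: ennreal_mult'' add: ennreal_leI)
    qed
    show "(\<integral>\<^sup>+t. ennreal (3 powr p) * ennreal ((cmod (g t) * wt t) powr p) \<partial>\<mu>) < \<infinity>"
      using g by (simp add: nn_integral_cmult in_Lp_iff energy_def ennreal_mult_less_top)
    show "AE t in \<mu>. (\<lambda>i. ennreal ((cmod (g t - G i t) * wt t) powr p)) \<longlonglongrightarrow> 0"
    proof (rule AE_I2)
      fix t
      have "(\<lambda>i. cmod (g t - G i t) * wt t) \<longlonglongrightarrow> cmod (g t - g t) * wt t"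
        by (intro tendsto_intros Glim)
      then have "(\<lambda>i. (cmod (g t - G i t) * wt t) powr p) \<longlonglongrightarrow> 0"
        using p wt_pos[of t] by (intro tendsto_zero_powrI[OF _ tendsto_const]) auto
      then show "(\<lambda>i. ennreal ((cmod (g t - G i t) * wt t) powr p)) \<longlonglongrightarrow> 0"
        using tendsto_ennrealI by fastforce
    qed
  qed auto
  then have lim: "(\<lambda>i. energy \<mu> p wt (\<lambda>t. g t - G i t)) \<longlonglongrightarrow> 0" by (simp add: energy_def)
  have "approx g"
  proof (rule approx_limit)
    fix e :: real assume "0 < e"
    then have "\<forall>\<^sub>F i in sequentially. energy \<mu> p wt (\<lambda>t. g t - G i t) < ennreal e"
      using lim by (intro order_tendstoD(2)) auto
    then obtain i where "energy \<mu> p wt (\<lambda>t. g t - G i t) < ennreal e"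
      by (auto simp: eventually_sequentially)
    moreover have "approx (G i)" unfolding G_def[abs_def] by (rule approx_simple[OF F(1)])
    ultimately show "\<exists>h. approx h \<and> energy \<mu> p wt (\<lambda>t. g t - h t) < ennreal e" by blast
  qed simp
  then show ?thesis using e by (simp add: approx_def)
qed

text \<open>
The sets \<open>E j\<close> are the finite unions of members of a countable base, so that one of them fits between
any compact set and any open set around it.
\<close>

lemma ex_dense_sequence:
  assumes sc: "second_countable (euclidean :: 'a topology)" and p: "1 \<le> p"
  obtains d :: "nat \<Rightarrow> 'a \<Rightarrow> complex"
  where "\<And>k. d k \<in> borel_measurable \<mu>"
    "\<And>k. \<exists>r M. \<forall>t. cmod (d k t) \<le> M * indicator {x. len x \<le> r} t"
    "\<And>g e. g \<in> Lp \<mu> p wt \<Longrightarrow> 0 < e \<Longrightarrow> \<exists>k. energy \<mu> p wt (\<lambda>t. g t - d k t) < ennreal e"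
proof -
  obtain \<B> :: "'a set set" where \<B>: "countable \<B>" "\<And>V. V \<in> \<B> \<Longrightarrow> open V"
    "\<And>U x. open U \<Longrightarrow> x \<in> U \<Longrightarrow> \<exists>V\<in>\<B>. x \<in> V \<and> V \<subseteq> U"
    using sc unfolding second_countable_def by (auto simp flip: open_openin)
  let ?F = "{A. finite A \<and> A \<subseteq> \<B>}"
  define E where "E j = \<Union>(from_nat_into ?F j)" for j
  have F: "countable ?F" by (rule countable_Collect_finite_subset[OF \<B>(1)])
  have Fne: "?F \<noteq> {}" by blast
  have E: "open (E j)" for j
    using from_nat_into[OF Fne, of j] \<B>(2) unfolding E_def by (intro open_Union) auto
  have basis: "\<exists>j. K \<subseteq> E j \<and> E j \<subseteq> U" if K: "compact K" "open U" "K \<subseteq> U" for K U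
  proof -
    let ?V = "{V \<in> \<B>. V \<subseteq> U}"
    have "K \<subseteq> \<Union>?V" 
    proof
      fix x assume "x \<in> K"
      then have "x \<in> U" using K(3) by blast
      then show "x \<in> \<Union>?V" using \<B>(3)[OF K(2)] by blast
    qed
    then obtain D where D: "D \<subseteq> ?V" "finite D" "K \<subseteq> \<Union>D"
      using compactE[OF K(1), of ?V] \<B>(2) by auto
    then have "D \<in> ?F" by blast
    then have "E (to_nat_on ?F D) = \<Union>D" unfolding E_def using F by (subst from_nat_into_to_nat_on) auto
    then show ?thesis using D by (intro exI[of _ "to_nat_on ?F D"]) auto
  qed
  obtain Z :: "complex set" where Z: "countable Z" "\<And>X. open X \<Longrightarrow> X \<noteq> {} \<Longrightarrow> \<exists>z\<in>Z. z \<in> X"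
    by (erule countable_dense_setE)
  have Zne: "Z \<noteq> {}" using Z(2)[of UNIV] by auto
  have c: "\<exists>i. cmod (z - from_nat_into Z i) < e" if e: "0 < e" for z e
  proof -
    obtain w where w: "w \<in> Z" "w \<in> ball z e" using Z(2)[of "ball z e"] e by auto
    then show ?thesis
      using from_nat_into_to_nat_on[OF Z(1) w(1)]
      by (intro exI[of _ "to_nat_on Z w"]) (auto simp: dist_norm)
  qed
  show thesis
  proof (rule that[of "\<lambda>k. step E (from_nat_into Z) (from_nat k)"])
    show "step E (from_nat_into Z) (from_nat k) \<in> borel_measurable \<mu>" for k
      by (rule step_measurable[OF E])
    show "\<exists>r M. \<forall>t. cmod (step E (from_nat_into Z) (from_nat k) t) \<le> M * indicator {x. len x \<le> r} t" for k
      by (rule step_bounded)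
    show "\<exists>k. energy \<mu> p wt (\<lambda>t. g t - step E (from_nat_into Z) (from_nat k) t) < ennreal e"
      if "g \<in> Lp \<mu> p wt" "0 < e" for g e
      using approx_by_step[OF p E basis c that] by (metis from_nat_to_nat)
  qed
qed

end

section \<open>Dense orbits along unbounded sets\<close>

context haar_length
begin

text \<open>
In a sum of three terms, one that is much longer than the other two determines the length up to 2.
\<close>

lemma len_far:
  assumes "len u + 3 + n \<le> len b" "len a + 3 \<le> len b"
  shows "n < len (a + (- b + u))" "n < len (b + (- a + u))"
proof -
  let ?x = "a + (- b + u)"
  have "b = (u + - ?x) + a"
    by (simp add: minus_add add.assoc)
  then have "len b \<le> max (max (len u) (len ?x) + 1) (len a) + 1"
    using len_add_le[of "u + - ?x" a] len_add_le[of u "- ?x"] by simp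
  then show "n < len ?x" using assms by linarith
  let ?y = "b + (- a + u)"
  have "b = (?y + - u) + a" by (simp add: add.assoc del: add_uminus_conv_diff)
  then have "len b \<le> max (max (len ?y) (len u) + 1) (len a) + 1"
    using len_add_le[of "?y + - u" a] len_add_le[of ?y "- u"] by simp
  then show "n < len ?y" using assms by linarith
qed

text \<open>
Starting the sequence at 0, rather than inside \<open>S\<close>, makes the dense vector \<open>f\<close> itself one of the translates
\<open>f (- s j + _)\<close> in \<open>superposition_energy\<close>, whose estimate then also puts \<open>f\<close> into the weighted space.
\<close>

lemma ex_fast_sequence:
  assumes unb: "\<And>n. \<exists>s\<in>S. n \<le> len s"
  obtains s :: "nat \<Rightarrow> 'a" where "s 0 = 0" "\<And>k. s (Suc k) \<in> S"
    "\<And>j k. j < k \<Longrightarrow> len (s j) + 3 + a k \<le> len (s k)"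
proof -
  define s where "s = rec_nat 0 (\<lambda>k x. SOME y. y \<in> S \<and> len x + 3 + a (Suc k) \<le> len y)"
  have s0: "s 0 = 0" by (simp add: s_def)
  have sS: "s (Suc k) \<in> S \<and> len (s k) + 3 + a (Suc k) \<le> len (s (Suc k))" for k
  proof -
    have "s (Suc k) = (SOME y. y \<in> S \<and> len (s k) + 3 + a (Suc k) \<le> len y)" by (simp add: s_def)
    moreover have "\<exists>y. y \<in> S \<and> len (s k) + 3 + a (Suc k) \<le> len y" using unb by blast
    ultimately show ?thesis by (metis (mono_tags, lifting) someI_ex)
  qed
  have mono: "len (s j) \<le> len (s k)" if "j \<le> k" for j k
    using that by (rule lift_Suc_mono_le[rotated]) (use sS in \<open>meson add_leD1 order_trans\<close>)
  have "len (s j) + 3 + a k \<le> len (s k)" if jk: "j < k" for j k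
  proof -
    obtain i where i: "k = Suc i" "j \<le> i" using jk by (cases k) auto
    then show ?thesis using sS[of i] mono[OF i(2)] by simp
  qed
  with s0 sS show thesis by (intro that[of s]) auto
qed

text \<open>
The function is \<open>f t = (\<Sum>k. D k (s k + t))\<close>. The \<open>k\<close>-th summand of its translate by \<open>s j\<close> is supported
on the points \<open>s j - s k + u\<close> with \<open>len u \<le> r k\<close>. For \<open>k = j\<close> it is \<open>D j\<close>. For \<open>k \<noteq> j\<close> the longer of
\<open>s j\<close> and \<open>s k\<close> dominates, so these points avoid the support of \<open>D j\<close>, which makes the summands
disjointly supported, and have length at least \<open>N (max j k)\<close>. There the weight makes up
for the integral \<open>I k\<close> and leaves at most \<open>(1 / 2) ^ j * (1 / 2) ^ k\<close>.
\<close>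

lemma superposition_energy:
  fixes D :: "nat \<Rightarrow> 'a \<Rightarrow> complex" and r :: "nat \<Rightarrow> nat" and s :: "nat \<Rightarrow> 'a"
  assumes p: "1 \<le> p"
    and D [measurable]: "\<And>k. D k \<in> borel_measurable \<mu>"
    and supp: "\<And>k t. D k t \<noteq> 0 \<Longrightarrow> len t \<le> r k"
    and I: "\<And>k. (\<integral>\<^sup>+t. ennreal (cmod (D k t) powr p) \<partial>\<mu>) \<le> ennreal (I k)" "\<And>k. 0 \<le> I k"
    and N: "\<And>j k. j \<le> k \<Longrightarrow> I j * 4 ^ k \<le> 2 ^ N k"
    and s: "\<And>j k. j < k \<Longrightarrow> len (s j) + 3 \<le> len (s k)"
      "\<And>i j k. i \<le> k \<Longrightarrow> j \<le> k \<Longrightarrow> j \<noteq> i \<Longrightarrow> r i + 3 + (r j + N k) \<le> len (s k)"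
  obtains f where "f \<in> borel_measurable \<mu>"
    "\<And>j. energy \<mu> p wt (\<lambda>t. f (- s j + t) - D j t) \<le> ennreal (2 * (1 / 2) ^ j)"
proof -
  have far: "r j + N (max j k) < len (s j + (- s k + u))"
    if "j \<noteq> k" and u: "len u \<le> r k" for j k u
  proof (cases "j < k")
    case True
    have "len u + 3 + (r j + N k) \<le> len (s k)" using s(2)[of k k j] True u by linarith
    from len_far(1)[OF this s(1)[OF True]] show ?thesis using True by (simp add: max_def)
  next
    case False
    then have kj: "k < j" using that(1) by simp
    have "len u + 3 + (r j + N j) \<le> len (s j)" using s(2)[of k j j] kj u by linarith
    from len_far(2)[OF this s(1)[OF kj]] show ?thesis using kj by (simp add: max_def)
  qed
  define f where "f t = (\<Sum>k. D k (s k + t))" for t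
  have f [measurable]: "f \<in> borel_measurable \<mu>"
    unfolding f_def[abs_def] by measurable
  have unique: "j = k" if "D j (s j + t) \<noteq> 0" "D k (s k + t) \<noteq> 0" for j k t
  proof (rule ccontr)
    assume "j \<noteq> k"
    from far[OF this supp[OF that(2)]] have "r j < len (s j + t)" by (simp add: add.assoc[symmetric])
    then show False using supp[OF that(1)] by simp
  qed
  have f_single: "f t = D k (s k + t)" if "D k (s k + t) \<noteq> 0" for k t
  proof -
    have "f t = (\<Sum>j\<in>{k}. D j (s j + t))"
      unfolding f_def using unique[OF _ that] by (intro suminf_finite) auto
    then show ?thesis by simp
  qed
  have bound: "energy \<mu> p wt (\<lambda>t. f (- s j + t) - D j t) \<le> ennreal (2 * (1 / 2) ^ j)" for j
  proof -
    \<comment> \<open>\<open>h k\<close> is the \<open>k\<close>-th contribution to the error, written in the variable \<open>u\<close> of \<open>D k\<close>\<close>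
    define h where "h k u = (if k = j then 0 else ennreal ((cmod (D k u) * wt (s j + (- s k + u))) powr p))" for k u
    have [measurable]: "h k \<in> borel_measurable \<mu>" for k
      unfolding h_def[abs_def] by measurable
    have cancel: "s j + (- s k + (s k + (- s j + t))) = t" for k t
      by simp
    have pw: "ennreal ((cmod (f (- s j + t) - D j t) * wt t) powr p) \<le> (\<Sum>k. h k (s k + (- s j + t)))" for t
    proof (cases "\<exists>k. D k (s k + (- s j + t)) \<noteq> 0")
      case False
      then have "f (- s j + t) = 0" by (simp add: f_def)
      moreover have "D j t = 0" using False[simplified, rule_format, of j] by (simp add: add.assoc[symmetric])
      ultimately show ?thesis using p by simp
    next
      case True
      then obtain k where k: "D k (s k + (- s j + t)) \<noteq> 0" by blast
      have fk: "f (- s j + t) = D k (s k + (- s j + t))" by (rule f_single[OF k])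
      show ?thesis
      proof (cases "k = j")
        case True
        then have "f (- s j + t) = D j t" using fk by (simp add: add.assoc[symmetric])
        then show ?thesis using p by simp
      next
        case False
        have "D j t = 0"
          using unique[of j "- s j + t", OF _ k] False by (auto simp: add.assoc[symmetric])
        then have "ennreal ((cmod (f (- s j + t) - D j t) * wt t) powr p) = h k (s k + (- s j + t))"
          using False by (simp add: fk h_def cancel)
        also have "\<dots> = (\<Sum>i\<in>{k}. h i (s i + (- s j + t)))" by simp
        also have "\<dots> \<le> (\<Sum>i. h i (s i + (- s j + t)))" by (rule sum_le_suminf) auto
        finally show ?thesis .
      qed
    qed
    have hint: "(\<integral>\<^sup>+t. h k (s k + (- s j + t)) \<partial>\<mu>) \<le> ennreal ((1 / 2) ^ j * (1 / 2) ^ k)" for k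
    proof (cases "k = j")
      case True
      then show ?thesis by (simp add: h_def)
    next
      case False
      define m where "m = max j k"
      have "(\<integral>\<^sup>+t. h k (s k + (- s j + t)) \<partial>\<mu>) = (\<integral>\<^sup>+t. h k t \<partial>\<mu>)"
        using nn_integral_left_shift[of "h k" "s k + - s j"]
        by (simp add: add.assoc del: add_uminus_conv_diff)
      also have "\<dots> \<le> (\<integral>\<^sup>+t. ennreal ((1 / 2) ^ N m) * ennreal (cmod (D k t) powr p) \<partial>\<mu>)"
      proof (rule nn_integral_mono)
        fix u
        let ?x = "s j + (- s k + u)"
        have "(cmod (D k u) * wt ?x) powr p \<le> (1 / 2) ^ N m * cmod (D k u) powr p"
        proof (cases "D k u = 0")
          case False
          have "N m \<le> len ?x" using far[OF \<open>k \<noteq> j\<close>[symmetric] supp[OF False]] by (simp add: m_def)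
          then have "wt ?x \<le> (1 / 2) ^ N m" unfolding wt_def by (intro power_decreasing) auto
          moreover have "wt ?x powr p \<le> wt ?x"
            using wt_pos[of ?x] wt_le_one[of ?x] p powr_mono'[of 1 p "wt ?x"] by simp
          ultimately have "cmod (D k u) powr p * wt ?x powr p \<le> cmod (D k u) powr p * (1 / 2) ^ N m"
            by (intro mult_left_mono) auto
          then show ?thesis using wt_pos[of ?x] by (simp add: powr_mult mult.commute)
        qed (use p in simp)
        then show "h k u \<le> ennreal ((1 / 2) ^ N m) * ennreal (cmod (D k u) powr p)"
          by (simp add: h_def ennreal_leI flip: ennreal_mult)
      qed
      also have "\<dots> = ennreal ((1 / 2) ^ N m) * (\<integral>\<^sup>+t. ennreal (cmod (D k t) powr p) \<partial>\<mu>)"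
        by (rule nn_integral_cmult) simp
      also have "\<dots> \<le> ennreal ((1 / 2) ^ N m) * ennreal (I k)" by (intro mult_left_mono I(1)) simp
      also have "\<dots> = ennreal ((1 / 2) ^ N m * I k)" using I(2) by (simp add: ennreal_mult)
      also have "\<dots> \<le> ennreal ((1 / 2) ^ j * (1 / 2) ^ k)"
      proof (rule ennreal_leI)
        have "(1 / 2) ^ N m * I k = I k * 4 ^ m / 2 ^ N m / 4 ^ m"
          by (simp add: power_one_over field_simps)
        also have "\<dots> \<le> 1 / 4 ^ m"
          using N[of k m] by (intro divide_right_mono) (auto simp: m_def divide_le_eq_1)
        \<comment> \<open>the factor \<open>4 ^ m\<close> in the hypothesis on \<open>N\<close> pays for both geometric factors\<close>
        also have "\<dots> = (1 / 2) ^ m * (1 / 2 :: real) ^ m"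
          by (simp add: power_one_over power_mult_distrib[symmetric])
        also have "\<dots> \<le> (1 / 2) ^ j * (1 / 2) ^ k"
          by (intro mult_mono power_decreasing) (auto simp: m_def)
        finally show "(1 / 2) ^ N m * I k \<le> (1 / 2) ^ j * (1 / 2) ^ k" .
      qed
      finally show ?thesis .
    qed
    have "energy \<mu> p wt (\<lambda>t. f (- s j + t) - D j t) \<le> (\<integral>\<^sup>+t. (\<Sum>k. h k (s k + (- s j + t))) \<partial>\<mu>)"
      unfolding energy_def by (rule nn_integral_mono) (rule pw)
    also have "\<dots> = (\<Sum>k. \<integral>\<^sup>+t. h k (s k + (- s j + t)) \<partial>\<mu>)"
      by (rule nn_integral_suminf) simp
    also have "\<dots> \<le> (\<Sum>k. ennreal ((1 / 2) ^ j * (1 / 2) ^ k))"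
      by (intro suminf_le hint) auto
    also have "\<dots> = ennreal ((1 / 2) ^ j * 2)"
      using sums_mult[OF geometric_sums[of "1 / 2 :: real"], of "(1 / 2) ^ j"]
      by (intro suminf_ennreal_eq) auto
    finally show ?thesis by (simp add: mult.commute)
  qed
  show thesis using f bound by (rule that)
qed

text \<open>
It remains to choose the sequence. Enumerating pairs \<open>(i, n)\<close> lists every \<open>d i\<close> infinitely
often, hence also at places \<open>j\<close> where the error \<open>2 * (1 / 2) ^ j\<close> is small. The
first entry \<open>D 0 = 0\<close> belongs to \<open>s 0 = 0\<close> and bounds the energy of the dense vector itself.
\<close>

lemma ex_dense_vector:
  assumes sc: "second_countable (euclidean :: 'a topology)" and p: "1 \<le> p"
    and unb: "\<And>n. \<exists>s\<in>S. n \<le> len s"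
  shows "\<exists>f. dense_vector \<mu> p wt S f"
proof -
  interpret weighted_haar \<mu> p wt by unfold_locales (use p weight_wt in auto)
  obtain d :: "nat \<Rightarrow> 'a \<Rightarrow> complex" where d: "\<And>k. d k \<in> borel_measurable \<mu>"
    "\<And>k. \<exists>r M. \<forall>t. cmod (d k t) \<le> M * indicator {x. len x \<le> r} t"
    "\<And>g e. g \<in> Lp \<mu> p wt \<Longrightarrow> 0 < e \<Longrightarrow> \<exists>k. energy \<mu> p wt (\<lambda>t. g t - d k t) < ennreal e"
    using ex_dense_sequence[OF sc p] by blast
  define D where "D k = (if k = 0 then (\<lambda>t. 0) else d (fst (prod_decode (k - 1))))" for k
  have D [measurable]: "D k \<in> borel_measurable \<mu>" for k using d(1) by (simp add: D_def)
  have "\<exists>r M. \<forall>t. cmod (D k t) \<le> M * indicator {x. len x \<le> r} t" for k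
  proof (cases "k = 0")
    case True
    then show ?thesis by (intro exI[of _ 0]) (simp add: D_def)
  next
    case False
    then show ?thesis using d(2)[of "fst (prod_decode (k - 1))"] by (simp add: D_def)
  qed
  then obtain r M where rM: "\<And>k t. cmod (D k t) \<le> M k * indicator {x. len x \<le> r k} t" by metis
  have supp: "len t \<le> r k" if "D k t \<noteq> 0" for k t
    using rM[of k t] that by (cases "len t \<le> r k") auto
  define I where "I k = M k powr p * measure \<mu> {x. len x \<le> r k}" for k
  have I0: "0 \<le> I k" for k by (simp add: I_def)
  have I: "(\<integral>\<^sup>+t. ennreal (cmod (D k t) powr p) \<partial>\<mu>) \<le> ennreal (I k)" for k
  proof -
    have "(\<integral>\<^sup>+t. ennreal (cmod (D k t) powr p) \<partial>\<mu>)
        \<le> (\<integral>\<^sup>+t. ennreal (M k powr p) * indicator {x. len x \<le> r k} t \<partial>\<mu>)"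
    proof (rule nn_integral_mono)
      fix t
      show "ennreal (cmod (D k t) powr p) \<le> ennreal (M k powr p) * indicator {x. len x \<le> r k} t"
        using rM[of k t] p by (cases "len t \<le> r k") (auto intro!: ennreal_leI powr_mono2)
    qed
    also have "\<dots> = ennreal (M k powr p) * emeasure \<mu> {x. len x \<le> r k}"
      by (simp add: nn_integral_cmult_indicator)
    also have "\<dots> = ennreal (I k)"
      using emeasure_len_le[of "r k"] by (simp add: I_def ennreal_mult emeasure_eq_ennreal_measure)
    finally show ?thesis .
  qed
  have "\<exists>n. (\<Sum>j\<le>k. I j) * 4 ^ k \<le> 2 ^ n" for k
    using real_arch_pow[of 2 "(\<Sum>j\<le>k. I j) * 4 ^ k"] by (auto intro: less_imp_le)
  then obtain N where N: "\<And>k. (\<Sum>j\<le>k. I j) * 4 ^ k \<le> 2 ^ N k" by metis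
  \<comment> \<open>controls at stage \<open>k\<close> all supports and all integrals up to \<open>k\<close>\<close>
  define a where "a k = 3 + (\<Sum>i\<le>k. r i) + N k" for k
  obtain s where s: "s 0 = 0" "\<And>k. s (Suc k) \<in> S"
    "\<And>j k. j < k \<Longrightarrow> len (s j) + 3 + a k \<le> len (s k)"
    using ex_fast_sequence[OF unb] by metis
  obtain f where f [measurable]: "f \<in> borel_measurable \<mu>"
    and fD: "\<And>j. energy \<mu> p wt (\<lambda>t. f (- s j + t) - D j t) \<le> ennreal (2 * (1 / 2) ^ j)"
  proof (rule superposition_energy[OF p D supp I I0, where N = N and s = s])
    show "I j * 4 ^ k \<le> 2 ^ N k" if "j \<le> k" for j k
    proof -
      have "I j \<le> (\<Sum>j\<le>k. I j)" using that I0 by (intro member_le_sum) auto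
      then have "I j * 4 ^ k \<le> (\<Sum>j\<le>k. I j) * 4 ^ k" by (intro mult_right_mono) auto
      also have "\<dots> \<le> 2 ^ N k" by (rule N)
      finally show ?thesis .
    qed
    show "len (s j) + 3 \<le> len (s k)" if "j < k" for j k using s(3)[OF that] by simp
    show "r i + 3 + (r j + N k) \<le> len (s k)" if "i \<le> k" "j \<le> k" "j \<noteq> i" for i j k
    proof -
      have "0 < k" using that by (cases k) auto
      moreover have "r i + r j \<le> (\<Sum>i\<le>k. r i)"
        using sum_mono2[of "{..k}" "{i, j}" r] that by auto
      ultimately show ?thesis using s(3)[of 0 k] by (simp add: a_def)
    qed
    fix f
    assume "f \<in> borel_measurable \<mu>"
      "\<And>j. energy \<mu> p wt (\<lambda>t. f (- s j + t) - D j t) \<le> ennreal (2 * (1 / 2) ^ j)"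
    then show thesis by (rule that)
  qed
  have "energy \<mu> p wt f \<le> ennreal 2"
    using fD[of 0] s(1) by (simp add: D_def)
  then have fL: "f \<in> Lp \<mu> p wt"
    by (auto simp: in_Lp_iff intro: le_less_trans)
  have tL: "left_translation x f \<in> Lp \<mu> p wt" for x
    using bounded_left_wt[OF p, of "- x"] fL by (auto simp: bounded_on_Lp_def left_translation_def)
  have "\<exists>x\<in>S. Lp_norm \<mu> p wt (\<lambda>t. left_translation x f t - g t) < e"
    if g: "g \<in> Lp \<mu> p wt" and e: "0 < e" for g e
  proof -
    define P where "P = (2 :: real) powr p"
    have P: "0 < P" by (simp add: P_def)
    define c where "c = e powr p"
    have c: "0 < c" using e by (simp add: c_def)
    then have c4: "0 < c / (4 * P)" using P by simp
    obtain i where i: "energy \<mu> p wt (\<lambda>t. g t - d i t) < ennreal (c / (4 * P))"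
      using d(3)[OF g c4] by blast
    obtain n where n: "(1 / 2) ^ n < c / (4 * P) / 2"
      using real_arch_pow_inv[of "c / (4 * P) / 2" "1 / 2"] c4 by auto
    define j where "j = Suc (prod_encode (i, n))"
    have Dj: "D j = d i" by (simp add: D_def j_def)
    have "n \<le> j" using le_prod_encode_2[of n i] by (simp add: j_def)
    then have "(1 / 2) ^ j \<le> (1 / 2 :: real) ^ n" by (intro power_decreasing) auto
    moreover have "2 * x \<le> y" if "x \<le> z" "z < y / 2" for x y z :: real
      using that by linarith
    ultimately have small: "2 * (1 / 2) ^ j \<le> c / (4 * P)" using n by blast
    have [measurable]: "g \<in> borel_measurable \<mu>" using g by (simp add: in_Lp_iff)
    have mt: "(\<lambda>t. f (- s j + t)) \<in> borel_measurable \<mu>"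
      using tL[of "s j"] by (simp add: in_Lp_iff left_translation_def)
    have "energy \<mu> p wt (\<lambda>t. left_translation (s j) f t - g t)
        \<le> ennreal P * (energy \<mu> p wt (\<lambda>t. f (- s j + t) - D j t) + energy \<mu> p wt (\<lambda>t. g t - d i t))"
      unfolding P_def
    proof (rule energy_add_le)
      show "(\<lambda>t. f (- s j + t) - D j t) \<in> borel_measurable \<mu>" using mt by simp
      show "(\<lambda>t. g t - d i t) \<in> borel_measurable \<mu>" using d(1) by simp
      show "cmod (left_translation (s j) f t - g t) \<le> cmod (f (- s j + t) - D j t) + cmod (g t - d i t)" for t
        using norm_triangle_ineq4[of "f (- s j + t) - D j t" "g t - d i t"]
        by (simp add: left_translation_def Dj)
    qed
    also have "\<dots> < ennreal c"
      using i small order_trans[OF fD[of j] ennreal_leI[OF small]] by (intro ennreal_scaled_lt P c) auto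
    finally have "Lp_norm \<mu> p wt (\<lambda>t. left_translation (s j) f t - g t) < e"
      unfolding c_def using Lp_diff[OF tL g] e by (simp add: Lp_norm_less_iff)
    moreover have "s j \<in> S" using s(2) by (simp add: j_def)
    ultimately show ?thesis by blast
  qed
  then have "dense_vector \<mu> p wt S f"
    using fL tL by (auto simp: dense_vector_def)
  then show ?thesis by blast
qed

lemma admissible_wt: "1 \<le> p \<Longrightarrow> admissible \<mu> p S wt"
  using bounded_left_wt by (simp add: admissible_def left_translation_def[abs_def])

lemma all_translations_bounded_wt: "1 \<le> p \<Longrightarrow> all_translations_bounded \<mu> p wt"
  using bounded_left_wt bounded_right_wt by (simp add: all_translations_bounded_def)

lemma unbounded_len:
  assumes "\<not> compact (closure S)" shows "\<exists>s\<in>S. n \<le> len s"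
proof (rule ccontr)
  assume "\<not> ?thesis"
  then have "S \<subseteq> {x. len x \<le> n}" by force
  then have "closure S \<subseteq> {x. len x \<le> n}" using closed_len_le by (rule closure_minimal)
  then have "compact (closure S)"
    using compact_Int_closed[OF compact_len_le[of n] closed_closure[of S]] by (simp add: Int_absorb1)
  with assms show False ..
qed

end

section \<open>Countable bases of topological groups\<close>

text \<open>
Compact neighbourhoods inside the \<open>W i\<close> shrink to \<open>{0}\<close>, so by compactness their finite intersections
form a neighbourhood base \<open>M\<close> at 0. As the group is \<open>\<sigma>\<close>-compact, countably many shifts of each
\<open>M i\<close> cover it, and these shifts are a base: one that contains \<open>x\<close> consists of points
\<open>x - v + v'\<close> with \<open>v, v' \<in> M i\<close>.
\<close>

lemma second_countable_topological_group:
  fixes R :: "nat \<Rightarrow> 'a::{topological_group_add, t2_space} set" and W :: "nat \<Rightarrow> 'a set"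
  assumes R: "\<And>n. compact (R n)" "(\<Union>n. R n) = UNIV"
    and W: "\<And>i. open (W i)" "\<And>i. 0 \<in> W i" "(\<Inter>i. W i) = {0}"
    and lc: "\<And>U. open U \<Longrightarrow> (0::'a) \<in> U \<Longrightarrow> \<exists>V L. open V \<and> compact L \<and> 0 \<in> V \<and> V \<subseteq> L \<and> L \<subseteq> U"
  shows "second_countable (euclidean :: 'a topology)"
proof -
  obtain V L where VL: "\<And>i. open (V i)" "\<And>i. compact (L i)" "\<And>i. 0 \<in> V i" "\<And>i. V i \<subseteq> L i" "\<And>i. L i \<subseteq> W i"
    using lc[OF W(1,2)] by metis
  define M where "M i = (\<Inter>j\<in>{..i}. V j)" for i :: nat
  have M: "open (M i)" "0 \<in> M i" for i
    using VL(1,3) by (auto simp: M_def)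
  have M_base: "\<exists>i. M i \<subseteq> U" if U: "open U" "0 \<in> U" for U
  proof -
    have "L 0 \<inter> (\<Inter>i\<in>UNIV. L i - U) = {}"
    proof -
      have "x \<in> U" if "\<And>i. x \<in> L i" for x
      proof -
        have "x \<in> (\<Inter>i. W i)" using that VL(5) by (intro INT_I) (meson subsetD)
        then show ?thesis using U(2) unfolding W(3) by simp
      qed
      then show ?thesis by auto
    qed
    then obtain I where I: "finite I" "L 0 \<inter> (\<Inter>i\<in>I. L i - U) = {}"
      using compact_imp_fip_image[OF VL(2)[of 0], of UNIV "\<lambda>i. L i - U"]
        compact_imp_closed[OF VL(2)] U(1) by (auto intro: closed_Diff)
    define i where "i = Max (insert 0 I)"
    have "M i \<subseteq> U"
    proof
      fix x assume x: "x \<in> M i"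
      have "x \<in> L j" if "j \<le> i" for j using x that VL(4) by (auto simp: M_def)
      moreover have "j \<le> i" if "j \<in> insert 0 I" for j
        unfolding i_def using I(1) that by (intro Max_ge) auto
      ultimately have "x \<in> L 0" "\<And>j. j \<in> I \<Longrightarrow> x \<in> L j" by auto
      then show "x \<in> U" using I(2) by auto
    qed
    then show ?thesis ..
  qed
  have "\<exists>D. countable D \<and> R m \<subseteq> (\<Union>y\<in>D. (+) y ` M i)" for i m
  proof -
    obtain y and n :: nat where "R m \<subseteq> (\<Union>l\<in>{0..<n}. (+) (y l) ` M i)"
      by (rule finite_cover_by_shifts[OF R(1)[of m] M[of i]])
    then show ?thesis by (intro exI[of _ "y ` {0..<n}"]) auto
  qed
  then have "\<forall>i m. \<exists>D. countable D \<and> R m \<subseteq> (\<Union>y\<in>D. (+) y ` M i)" by blast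
  then obtain D where "\<forall>i m. countable (D i m) \<and> R m \<subseteq> (\<Union>y\<in>D i m. (+) y ` M i)"
    unfolding choice_iff by blast
  then have D: "\<And>i m. countable (D i m)" "\<And>i m. R m \<subseteq> (\<Union>y\<in>D i m. (+) y ` M i)" by blast+
  define B where "B = (\<Union>i m. (\<lambda>y. (+) y ` M i) ` D i m)"
  have "\<exists>S\<in>B. x \<in> S \<and> S \<subseteq> U" if U: "open U" "x \<in> U" for U x
  proof -
    have "open ((\<lambda>(v, v'). x + (- v + v')) -` U)"
      using U(1) by (auto simp: case_prod_unfold intro!: open_vimage continuous_intros)
    moreover have "(0, 0) \<in> (\<lambda>(v, v'). x + (- v + v')) -` U" using U(2) by simp
    ultimately obtain A A' where A: "open A" "open A'" "(0, 0) \<in> A \<times> A'"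
        "A \<times> A' \<subseteq> (\<lambda>(v, v'). x + (- v + v')) -` U"
      by (rule open_prod_elim)
    then obtain i where i: "M i \<subseteq> A \<inter> A'" using M_base[of "A \<inter> A'"] by auto
    have "x \<in> (\<Union>m. R m)" unfolding R(2) by simp
    then obtain m where "x \<in> R m" by blast
    then obtain y where y: "y \<in> D i m" "x \<in> (+) y ` M i" using D(2)[of m i] by blast
    then obtain v where v: "v \<in> M i" "x = y + v" by blast
    have "(+) (y) ` M i \<subseteq> U"
    proof
      fix z assume "z \<in> (+) (y) ` M i"
      then obtain v' where v': "v' \<in> M i" "z = y + v'" by blast
      have "(v, v') \<in> A \<times> A'" using v(1) v'(1) i by blast
      then have "x + (- v + v') \<in> U" using A(4) by auto
      moreover have "x + (- v + v') = z" unfolding v(2) v'(2) by (simp add: add.assoc)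
      ultimately show "z \<in> U" by simp
    qed
    moreover have "(+) (y) ` M i \<in> B" unfolding B_def using y(1) by blast
    ultimately show ?thesis using y(2) by blast
  qed
  moreover have "countable B" unfolding B_def using D(1) by simp
  moreover have "\<forall>S\<in>B. open S" unfolding B_def using M(1) by (auto intro: open_image_left_shift)
  ultimately show ?thesis
    unfolding second_countable_def by (auto simp flip: open_openin intro!: exI[of _ B])
qed

section \<open>Right shifts that preserve a function almost everywhere\<close>

context haar
begin

lemma emeasure_zeroI: "(\<And>e. 0 < e \<Longrightarrow> emeasure \<mu> A \<le> ennreal e) \<Longrightarrow> emeasure \<mu> A = 0"
  using ennreal_le_epsilon[of 0 "emeasure \<mu> A"] by simp

lemma AE_vimage:
  fixes \<phi> :: "'a \<Rightarrow> 'a"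
  assumes P: "AE t in \<mu>. P t"
    and \<phi>: "\<And>A. A \<in> sets borel \<Longrightarrow> \<phi> -` A \<in> sets borel"
    and c: "\<And>A. A \<in> sets borel \<Longrightarrow> emeasure \<mu> (\<phi> -` A) \<le> c * emeasure \<mu> A"
  shows "AE t in \<mu>. P (\<phi> t)"
proof -
  obtain N where N: "N \<in> null_sets \<mu>" "{t. \<not> P t} \<subseteq> N"
    using P by (auto simp: eventually_ae_filter)
  have Nb: "N \<in> sets borel" "emeasure \<mu> N = 0" using N(1) by auto
  have "\<phi> -` N \<in> null_sets \<mu>" using c[OF Nb(1)] \<phi>[OF Nb(1)] Nb(2) by (intro null_setsI) auto
  then show ?thesis by (rule AE_I') (use N(2) in auto)
qed

lemma AE_left_shift: "AE t in \<mu>. P t \<Longrightarrow> AE t in \<mu>. P (g + t)"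
  by (rule AE_vimage[where c = 1]) (auto simp: emeasure_vimage_left_shift borel_left_shift)

lemma AE_right_shift: 
  assumes "AE t in \<mu>. P t" shows "AE t in \<mu>. P (t + g)"
  using emeasure_right_shift_le[of g] AE_vimage[OF assms, of "\<lambda>t. t + g"] borel_right_shift by metis

lemma not_AE_avoiding_open:
  assumes "AE t in \<mu>. \<not> (P t)" "open V" "x \<in> V" shows "\<not> (\<forall>t\<in>V. P t)"
proof
  assume V: "\<forall>t\<in>V. P t"
  have "AE t in \<mu>. t \<notin> V" using assms(1) by eventually_elim (use V in blast)
  then have "emeasure \<mu> V = 0"
    using assms(2) by (subst (asm) AE_iff_null_sets[symmetric]) auto
  with emeasure_open_pos[OF assms(2,3)] show False by simp
qed

text \<open>
If \<open>K i \<subseteq> A \<subseteq> U i\<close> with small differences and \<open>n\<close> is so close to 0 that \<open>K i + n\<close> and \<open>K i - n\<close> stay in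
\<open>U i\<close>, then \<open>A\<close> and its shift by \<open>n\<close> differ only inside small sets and their right shifts. The latter are
small as well, because right shifts distort \<open>\<mu>\<close> by a bounded factor. If \<open>n\<close> meets this for all \<open>i\<close>, the
difference is null.
\<close>

lemma almost_invariance_nbhds:
  assumes A: "A \<in> sets borel" "emeasure \<mu> A < \<infinity>"
  obtains W :: "nat \<Rightarrow> 'a set" where "\<And>i. open (W i)" "\<And>i. 0 \<in> W i"
    "\<And>n. (\<And>i. n \<in> W i) \<Longrightarrow> AE t in \<mu>. t + n \<in> A \<longleftrightarrow> t \<in> A"
proof -
  define e where "e i = 1 / real (Suc i)" for i
  have e: "0 < e i" for i by (simp add: e_def)
  have "\<exists>K. compact K \<and> K \<subseteq> A \<and> emeasure \<mu> (A - K) < ennreal (e i)" for i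
    using inner_regular[OF A e] by metis
  then obtain K where K: "\<And>i. compact (K i)" "\<And>i. K i \<subseteq> A" "\<And>i. emeasure \<mu> (A - K i) < ennreal (e i)"
    by metis
  have "\<exists>U. open U \<and> A \<subseteq> U \<and> emeasure \<mu> (U - A) < ennreal (e i)" for i
    using outer_approx[OF A e] by metis
  then obtain U where U: "\<And>i. open (U i)" "\<And>i. A \<subseteq> U i" "\<And>i. emeasure \<mu> (U i - A) < ennreal (e i)"
    by metis
  have "\<exists>W. open W \<and> 0 \<in> W \<and> (\<forall>w\<in>W. - w \<in> W) \<and> (\<forall>k\<in>K i. \<forall>w\<in>W. k + w \<in> U i)" for i
    using compact_shift_into_open[OF K(1)[of i] U(1)[of i]] K(2) U(2) by (metis order_trans)
  then obtain W where W: "\<And>i. open (W i)" "\<And>i. 0 \<in> W i" "\<And>i w. w \<in> W i \<Longrightarrow> - w \<in> W i"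
      "\<And>i k w. k \<in> K i \<Longrightarrow> w \<in> W i \<Longrightarrow> k + w \<in> U i"
    by metis
  show thesis
  proof (rule that[of W])
    fix n assume n: "\<And>i. n \<in> W i"
    obtain c :: ennreal where c: "c < \<infinity>"
      "\<And>A. A \<in> sets borel \<Longrightarrow> emeasure \<mu> ((\<lambda>x. x + n) -` A) \<le> c * emeasure \<mu> A"
      using emeasure_right_shift_le[of n] by metis
    obtain C where C: "c = ennreal C" "0 \<le> C" using c(1) by (cases c) auto
    define D where "D = {t. \<not> (t + n \<in> A \<longleftrightarrow> t \<in> A)}"
    have "D = ((\<lambda>t. t + n) -` A - A) \<union> (A - (\<lambda>t. t + n) -` A)" by (auto simp: D_def)
    then have Db: "D \<in> sets borel" using A(1) borel_right_shift[OF A(1), of n] by auto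
    have le: "emeasure \<mu> D \<le> ennreal ((2 + 2 * C) * e i)" for i
    proof -
      have Kb: "A - K i \<in> sets borel" "U i - A \<in> sets borel"
        using A(1) U(1) compact_imp_closed[OF K(1)] by auto
      note sb = borel_right_shift[OF Kb(1), of n] borel_right_shift[OF Kb(2), of n]
      have "t \<in> ((A - K i) \<union> (\<lambda>t. t + n) -` (U i - A)) \<union> ((\<lambda>t. t + n) -` (A - K i) \<union> (U i - A))"
        if "t \<in> D" for t
      proof (cases "t \<in> A")
        case True
        then show ?thesis using that W(4)[of t i n] n by (auto simp: D_def)
      next
        case False
        then have "t + n \<in> A" using that by (auto simp: D_def)
        moreover have "t \<in> U i" if "t + n \<in> K i"
          using W(4)[OF that W(3)[OF n]] by (simp add: add.assoc)
        ultimately show ?thesis using False by auto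
      qed
      then have "emeasure \<mu> D \<le> emeasure \<mu>
          (((A - K i) \<union> (\<lambda>t. t + n) -` (U i - A)) \<union> ((\<lambda>t. t + n) -` (A - K i) \<union> (U i - A)))"
        using sb Kb by (intro emeasure_mono) auto
      also have "\<dots> \<le> (emeasure \<mu> (A - K i) + emeasure \<mu> ((\<lambda>t. t + n) -` (U i - A)))
          + (emeasure \<mu> ((\<lambda>t. t + n) -` (A - K i)) + emeasure \<mu> (U i - A))"
        using sb Kb
        by (intro order_trans[OF emeasure_subadditive] add_mono emeasure_subadditive) auto
      also have "\<dots> \<le> (ennreal (e i) + c * ennreal (e i)) + (c * ennreal (e i) + ennreal (e i))"
        using K(3)[of i] U(3)[of i]
        by (intro add_mono order_trans[OF c(2)] mult_left_mono Kb) auto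
      also have "\<dots> = ennreal ((e i + C * e i) + (C * e i + e i))"
      proof -
        have "0 \<le> e i" "0 \<le> C * e i" using C(2) less_imp_le[OF e[of i]] by auto
        moreover have "c * ennreal (e i) = ennreal (C * e i)"
          using C \<open>0 \<le> e i\<close> by (simp add: ennreal_mult)
        ultimately show ?thesis by (simp only: ennreal_plus add_nonneg_nonneg)
      qed
      also have "(e i + C * e i) + (C * e i + e i) = (2 + 2 * C) * e i" by (simp add: algebra_simps)
      finally show ?thesis .
    qed
    have "emeasure \<mu> D = 0"
    proof (rule emeasure_zeroI)
      fix \<epsilon> :: real assume \<epsilon>: "0 < \<epsilon>"
      obtain i where "e i < \<epsilon> / (2 + 2 * C)"
        using nat_approx_posE[of "\<epsilon> / (2 + 2 * C)"] \<epsilon> C(2) by (auto simp: e_def)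
      then have "(2 + 2 * C) * e i \<le> \<epsilon>" using C(2) by (simp add: field_simps)
      then show "emeasure \<mu> D \<le> ennreal \<epsilon>"
        using le[of i] ennreal_leI order_trans by blast
    qed
    then show "AE t in \<mu>. t + n \<in> A \<longleftrightarrow> t \<in> A"
      using Db by (intro AE_I[of _ _ D]) (auto simp: D_def)
  qed (use W in auto)
qed

text \<open>
A function is determined by the preimages of a countable base of the plane; cutting these down to the
sets \<open>R m\<close> makes their measures finite.
\<close>

lemma almost_invariance_nbhds_function:
  fixes f :: "'a \<Rightarrow> complex" and R :: "nat \<Rightarrow> 'a set"
  assumes R: "\<And>n. compact (R n)" "(\<Union>n. R n) = UNIV" and f: "f \<in> borel_measurable \<mu>"
  obtains W :: "nat \<Rightarrow> 'a set" where "\<And>i. open (W i)" "\<And>i. 0 \<in> W i"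
    "\<And>n. (\<And>i. n \<in> W i) \<Longrightarrow> AE t in \<mu>. f (t + n) = f t"
proof -
  obtain \<B> :: "complex set set" where \<B>: "countable \<B>" "topological_basis \<B>"
    using ex_countable_basis by blast
  have ne: "\<B> \<noteq> {}" using topological_basisE[OF \<B>(2) open_UNIV, of 0] by blast
  define b where "b = from_nat_into \<B>"
  have b: "open (b k)" for k
    unfolding b_def using from_nat_into[OF ne] topological_basis_open[OF \<B>(2)] by blast
  have sep: "\<exists>k. x \<in> b k \<and> y \<notin> b k" if xy: "x \<noteq> y" for x y :: complex
  proof -
    obtain V where V: "open V" "x \<in> V" "y \<notin> V" using t1_space[OF xy] by metis
    then obtain B where B: "B \<in> \<B>" "x \<in> B" "B \<subseteq> V" using topological_basisE[OF \<B>(2)] by metis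
    then show ?thesis
      using V(3) from_nat_into_to_nat_on[OF \<B>(1) B(1)]
      by (intro exI[of _ "to_nat_on \<B> B"]) (auto simp: b_def)
  qed
  define A where "A k m = f -` b k \<inter> R m" for k m
  have A: "A k m \<in> sets borel" for k m
  proof -
    have "f -` b k \<inter> space \<mu> \<in> sets \<mu>" using b by (intro measurable_sets[OF f]) auto
    then show ?thesis using compact_imp_closed[OF R(1)] by (auto simp: A_def)
  qed
  have Afin: "emeasure \<mu> (A k m) < \<infinity>" for k m
  proof -
    have "emeasure \<mu> (A k m) \<le> emeasure \<mu> (R m)"
      using compact_imp_closed[OF R(1)] by (intro emeasure_mono) (auto simp: A_def)
    then show ?thesis using emeasure_compact[OF R(1)[of m]] by simp
  qed
  have "\<exists>W :: nat \<Rightarrow> 'a set. (\<forall>i. open (W i)) \<and> (\<forall>i. 0 \<in> W i) \<and>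
      (\<forall>n. (\<forall>i. n \<in> W i) \<longrightarrow> (AE t in \<mu>. t + n \<in> A k m \<longleftrightarrow> t \<in> A k m))" for k m
    using almost_invariance_nbhds[OF A Afin] by metis
  then obtain W :: "nat \<Rightarrow> nat \<Rightarrow> nat \<Rightarrow> 'a set" where W: "\<And>k m i. open (W k m i)" "\<And>k m i. 0 \<in> W k m i"
      "\<And>k m n. (\<forall>i. n \<in> W k m i) \<Longrightarrow> (AE t in \<mu>. t + n \<in> A k m \<longleftrightarrow> t \<in> A k m)"
    by metis
  define V where "V j = (case from_nat j of (k, m, i) \<Rightarrow> W k m i)" for j
  show thesis
  proof (rule that[of V])
    show "open (V j)" "0 \<in> V j" for j using W(1,2) by (auto simp: V_def split: prod.split)
    fix n assume n: "\<And>j. n \<in> V j"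
    have "n \<in> W k m i" for k m i
      using n[of "to_nat (k, m, i)"] by (simp add: V_def)
    then have "AE t in \<mu>. \<forall>k m. t + n \<in> A k m \<longleftrightarrow> t \<in> A k m"
      using W(3) by (simp add: AE_all_countable)
    then show "AE t in \<mu>. f (t + n) = f t"
    proof eventually_elim
      case (elim t)
      show ?case
      proof (rule ccontr)
        assume "f (t + n) \<noteq> f t"
        then obtain k where k: "f t \<in> b k" "f (t + n) \<notin> b k" using sep by metis
        have "t \<in> (\<Union>m. R m)" unfolding R(2) by simp
        then obtain m where "t \<in> R m" by blast
        then show False using elim k by (auto simp: A_def)
      qed
    qed
  qed
qed

end

section \<open>Consequences of a dense orbit\<close>

context weighted_haar
begin

lemma indicator_in_Lp:
  assumes "compact K" "A \<in> sets borel" "A \<subseteq> K"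
  shows "(\<lambda>t. indicator A t :: complex) \<in> Lp \<mu> p \<omega>"
proof -
  note [measurable] = assms(2)
  have [measurable]: "K \<in> sets borel" using compact_imp_closed[OF assms(1)] by auto
  have "integrable \<mu> (\<lambda>t. indicator K t *\<^sub>R (\<omega> t powr p))"
    using weight assms(1) by (auto simp: weight_def set_integrable_def)
  then have "integrable \<mu> (\<lambda>t. (cmod (indicator A t) * \<omega> t) powr p)"
    by (rule Bochner_Integration.integrable_bound)
      (use assms(3) p in \<open>auto simp: indicator_def subset_iff\<close>)
  then show ?thesis by (simp add: Lp_def)
qed

text \<open>
The sets where \<open>(cmod (f t) * \<omega> t) powr p\<close> exceeds \<open>1 / m\<close> have finite measure, and such sets are
\<open>\<sigma>\<close>-compact up to null sets.
\<close>

lemma Lp_support_sigma_compact: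
  assumes f: "f \<in> Lp \<mu> p \<omega>"
  obtains Q :: "nat \<Rightarrow> 'a set" where "\<And>n. compact (Q n)" "AE t in \<mu>. f t \<noteq> 0 \<longrightarrow> t \<in> (\<Union>n. Q n)"
proof -
  have [measurable]: "f \<in> borel_measurable \<mu>" using f by (simp add: in_Lp_iff)
  define F where "F t = (cmod (f t) * \<omega> t) powr p" for t
  have [measurable]: "F \<in> borel_measurable \<mu>" unfolding F_def[abs_def] by measurable
  define A where "A m = {t. 1 \<le> ennreal (real m) * ennreal (F t)}" for m :: nat
  have A: "A m \<in> sets borel" for m
  proof -
    have "{t \<in> space \<mu>. 1 \<le> ennreal (real m) * ennreal (F t)} \<in> sets \<mu>" by measurable
    then show ?thesis by (simp add: A_def)
  qed
  have Afin: "emeasure \<mu> (A m) < \<infinity>" for m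
  proof -
    have "emeasure \<mu> (A m) \<le> ennreal (real m) * (\<integral>\<^sup>+t. ennreal (F t) * indicator UNIV t \<partial>\<mu>)"
      using nn_integral_Markov_inequality[of "\<lambda>t. ennreal (F t)" UNIV \<mu> "ennreal (real m)"]
      by (simp add: A_def)
    also have "\<dots> < \<infinity>"
      using f by (simp add: in_Lp_iff energy_def F_def ennreal_mult_less_top)
    finally show ?thesis .
  qed
  have "\<exists>K. compact K \<and> K \<subseteq> A m \<and> emeasure \<mu> (A m - K) < ennreal (1 / real (Suc i))" for m i
    using inner_regular[OF A Afin, of "1 / real (Suc i)" m] by (metis zero_less_divide_1_iff of_nat_0_less_iff zero_less_Suc)
  then obtain K where K: "\<And>m i. compact (K m i)" "\<And>m i. emeasure \<mu> (A m - K m i) < ennreal (1 / real (Suc i))"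
    by metis
  define Q where "Q n = (case from_nat n of (m, i) \<Rightarrow> K m i)" for n
  have null: "AE t in \<mu>. t \<notin> A m - (\<Union>i. K m i)" for m
  proof -
    have Kb: "K m i \<in> sets borel" for i using compact_imp_closed[OF K(1)] by auto
    have "emeasure \<mu> (A m - (\<Union>i. K m i)) = 0"
    proof (rule emeasure_zeroI)
      fix e :: real assume "0 < e"
      then obtain i where i: "1 / real (Suc i) < e" by (rule nat_approx_posE)
      have "emeasure \<mu> (A m - (\<Union>i. K m i)) \<le> emeasure \<mu> (A m - K m i)"
        using A Kb by (intro emeasure_mono) auto
      also have "\<dots> \<le> ennreal (1 / real (Suc i))" using K(2) by (rule less_imp_le)
      also have "\<dots> \<le> ennreal e" using i by (intro ennreal_leI) simp
      finally show "emeasure \<mu> (A m - (\<Union>i. K m i)) \<le> ennreal e" .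
    qed
    then show ?thesis using A Kb by (intro AE_not_in null_setsI) auto
  qed
  show thesis
  proof (rule that[of Q])
    show "compact (Q n)" for n using K(1) by (auto simp: Q_def split: prod.split)
    have "AE t in \<mu>. \<forall>m. t \<notin> A m - (\<Union>i. K m i)" using null by (simp add: AE_all_countable)
    then show "AE t in \<mu>. f t \<noteq> 0 \<longrightarrow> t \<in> (\<Union>n. Q n)"
    proof (eventually_elim, intro impI)
      fix t assume t: "\<forall>m. t \<notin> A m - (\<Union>i. K m i)" "f t \<noteq> 0"
      have F: "0 < F t" using t(2) weight_pos[of t] by (simp add: F_def)
      obtain m :: nat where "1 < real m * F t" using reals_Archimedean3[OF F] by blast
      then have "t \<in> A m" using F by (simp add: A_def flip: ennreal_mult)
      then obtain i where "t \<in> K m i" using t(1) by blast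
      then have "t \<in> Q (to_nat (m, i))" by (simp add: Q_def)
      then show "t \<in> (\<Union>n. Q n)" by blast
    qed
  qed
qed

text \<open>
Let \<open>Q\<close> be a \<open>\<sigma>\<close>-compact set that carries \<open>f\<close>. If a shift \<open>s + Q\<close> meets both \<open>K\<close> and \<open>a + K\<close>, then
\<open>a \<in> K - Q + Q - K\<close>. So for \<open>a\<close> outside this \<open>\<sigma>\<close>-compact set every translate of \<open>f\<close>
vanishes almost everywhere on \<open>K\<close> or on \<open>a + K\<close>, which keeps it away from the indicator of their union.
\<close>

lemma dense_vector_imp_sigma_compact:
  assumes dense: "dense_vector \<mu> p \<omega> S f"
  obtains R :: "nat \<Rightarrow> 'a set" where "\<And>n. compact (R n)" "(\<Union>n. R n) = UNIV"
proof -
  have fL: "f \<in> Lp \<mu> p \<omega>" using dense by (simp add: dense_vector_def)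
  obtain Q :: "nat \<Rightarrow> 'a set" where Q: "\<And>n. compact (Q n)" "AE t in \<mu>. f t \<noteq> 0 \<longrightarrow> t \<in> (\<Union>n. Q n)"
  proof (rule Lp_support_sigma_compact[OF fL])
    fix Q :: "nat \<Rightarrow> 'a set"
    assume "\<And>n. compact (Q n)" "AE t in \<mu>. f t \<noteq> 0 \<longrightarrow> t \<in> (\<Union>n. Q n)"
    then show thesis by (rule that)
  qed
  obtain V K :: "'a set" where V: "open V" "compact K" "0 \<in> V" "V \<subseteq> K"
    using compact_nbhd[of UNIV 0] by auto
  define add where "add = (\<lambda>A B :: 'a set. (\<lambda>(x, y). x + y) ` (A \<times> B))"
  have addI: "x + y \<in> add A B" if "x \<in> A" "y \<in> B" for x y A B
    unfolding add_def using that by (intro image_eqI[of _ _ "(x, y)"]) auto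
  define R where "R n = (case from_nat n of (i, j) \<Rightarrow>
    add (add K (uminus ` Q i)) (add (Q j) (uminus ` K)))" for n
  have R: "compact (R n)" for n
    using Q(1) V(2) unfolding R_def add_def
    by (auto split: prod.split intro!: compact_sum_set compact_image_uminus)
  have "a \<in> (\<Union>n. R n)" for a
  proof (rule ccontr)
    assume a: "a \<notin> (\<Union>n. R n)"
    have miss: "(\<forall>q\<in>\<Union>n. Q n. s + q \<notin> K) \<or> (\<forall>q\<in>\<Union>n. Q n. s + q \<notin> (+) a ` K)" for s
    proof (rule ccontr)
      assume "\<not> ?thesis"
      then obtain i q j q' v' where q: "q \<in> Q i" "s + q \<in> K" "q' \<in> Q j" "v' \<in> K" "s + q' = a + v'"
        by auto
      have "a = ((s + q) + - q) + (q' + - v')"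
        using q(5) by (metis add.assoc add.right_inverse add.right_neutral add_diff_cancel diff_conv_add_uminus)
      moreover have "(s + q) + - q \<in> add K (uminus ` Q i)" "q' + - v' \<in> add (Q j) (uminus ` K)"
        using q by (auto intro!: addI simp del: add_uminus_conv_diff)
      ultimately have "a \<in> add (add K (uminus ` Q i)) (add (Q j) (uminus ` K))"
        using addI by metis
      then have "a \<in> R (to_nat (i, j))" by (simp add: R_def)
      then show False using a by blast
    qed
    let ?B = "K \<union> (+) a ` K"
    have aK: "compact ((+) a ` K)" by (rule compact_image_left_shift[OF V(2)])
    have Kb [measurable]: "K \<in> sets borel" "(+) a ` K \<in> sets borel"
      using compact_imp_closed[OF V(2)] compact_imp_closed[OF aK] by auto
    have gL: "(\<lambda>t. indicator ?B t) \<in> Lp \<mu> p \<omega>"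
      using V(2) aK by (intro indicator_in_Lp[of ?B]) (auto intro: compact_Un)
    \<comment> \<open>the smaller of \<open>J K\<close> and \<open>J (a + K)\<close> will bound the energy of the difference from below\<close>
    define J where "J B = energy \<mu> p \<omega> (indicator B)" for B
    have J: "0 < J B" if "open U" "x \<in> U" "U \<subseteq> B" "B \<in> sets borel" for U x B
    proof (rule ccontr)
      note [measurable] = that(4)
      assume "\<not> 0 < J B"
      then have "(\<integral>\<^sup>+t. ennreal ((cmod (indicator B t) * \<omega> t) powr p) \<partial>\<mu>) = 0"
        by (simp add: J_def energy_def)
      then have ae: "AE t in \<mu>. ennreal ((cmod (indicator B t) * \<omega> t) powr p) = 0"
        by (subst (asm) nn_integral_0_iff_AE) auto
      have "AE t in \<mu>. \<not> t \<in> B"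
        using ae
      proof eventually_elim
        case (elim t)
        then show ?case using weight_pos[of t] by (auto simp: ennreal_eq_0_iff)
      qed
      from not_AE_avoiding_open[OF this that(1,2)] that(3) show False by blast
    qed
    have J1: "0 < J K" by (rule J[OF V(1,3,4) Kb(1)])
    have J2: "0 < J ((+) a ` K)"
      by (rule J[OF open_image_left_shift[OF V(1)] imageI[OF V(3)]]) (use V Kb in auto)
    have "J K < \<infinity>"
      using indicator_in_Lp[OF V(2) Kb(1)] by (simp add: in_Lp_iff J_def)
    then obtain c where c: "min (J K) (J ((+) a ` K)) = ennreal c" "0 < c"
      using J1 J2 by (cases "min (J K) (J ((+) a ` K))") (auto simp: min_def split: if_splits)
    have "0 < c powr (1 / p)" using c(2) by simp
    then obtain s where s: "s \<in> S"
        "Lp_norm \<mu> p \<omega> (\<lambda>t. left_translation s f t - indicator ?B t) < c powr (1 / p)"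
      using dense gL unfolding dense_vector_def by blast
    have "(\<lambda>t. left_translation s f t - indicator ?B t) \<in> Lp \<mu> p \<omega>"
      using dense s(1) gL by (intro Lp_diff) (auto simp: dense_vector_def)
    then have small: "energy \<mu> p \<omega> (\<lambda>t. left_translation s f t - indicator ?B t) < ennreal c"
      using s(2) c(2) p by (simp add: Lp_norm_less_iff powr_powr)
    have large: "J B \<le> energy \<mu> p \<omega> (\<lambda>t. left_translation s f t - indicator ?B t)"
      if B: "B \<subseteq> ?B" "\<forall>q\<in>\<Union>n. Q n. s + q \<notin> B" for B
      unfolding J_def energy_def
    proof (rule nn_integral_mono_AE)
      show "AE t in \<mu>. ennreal ((cmod (indicator B t) * \<omega> t) powr p)
          \<le> ennreal ((cmod (left_translation s f t - indicator ?B t) * \<omega> t) powr p)"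
        using AE_left_shift[OF Q(2), of "- s"]
      proof eventually_elim
        case (elim t)
        show ?case
        proof (cases "t \<in> B")
          case True
          have "f (- s + t) = 0"
          proof (rule ccontr)
            assume "f (- s + t) \<noteq> 0"
            with elim have "- s + t \<in> (\<Union>n. Q n)" by blast
            with B(2) have "s + (- s + t) \<notin> B" by blast
            then show False using True by simp
          qed
          moreover have "t \<in> ?B" using True B(1) by blast
          ultimately show ?thesis using True by (simp add: left_translation_def)
        qed (use p in simp)
      qed
    qed
    have "ennreal c \<le> energy \<mu> p \<omega> (\<lambda>t. left_translation s f t - indicator ?B t)"
      using miss[of s] large[of K] large[of "(+) a ` K"] unfolding c(1)[symmetric]
      by (auto simp: min_le_iff_disj)
    with small show False by simp
  qed
  then show thesis using R by (intro that[of R]) auto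
qed

text \<open>
If \<open>f (t + n) = f t\<close> almost everywhere, then left translates of \<open>f\<close> and their almost everywhere limits
have the same property, so a dense orbit transfers it to the indicator of every small open set \<open>V\<close>. For \<open>n \<noteq> 0\<close> there is such a
\<open>V\<close> around 0 disjoint from its shift, which would then be null.
\<close>

theorem dense_vector_imp_second_countable:
  assumes dense: "dense_vector \<mu> p \<omega> S f"
  shows "second_countable (euclidean :: 'a topology)"
proof -
  obtain R :: "nat \<Rightarrow> 'a set" where R: "\<And>n. compact (R n)" "(\<Union>n. R n) = UNIV"
    using dense_vector_imp_sigma_compact[OF dense] by metis
  have "f \<in> borel_measurable \<mu>" using dense by (simp add: dense_vector_def in_Lp_iff)
  then obtain W :: "nat \<Rightarrow> 'a set" where W: "\<And>i. open (W i)" "\<And>i. 0 \<in> W i"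
    "\<And>n. (\<And>i. n \<in> W i) \<Longrightarrow> AE t in \<mu>. f (t + n) = f t"
    using almost_invariance_nbhds_function[OF R] by metis
  have "n = 0" if n: "\<And>i. n \<in> W i" for n
  proof (rule ccontr)
    assume "n \<noteq> 0"
    then obtain A B where AB: "open A" "open B" "0 \<in> A" "n \<in> B" "A \<inter> B = {}"
      using hausdorff[of 0 n] by metis
    obtain V0 K :: "'a set" where V0: "open V0" "compact K" "0 \<in> V0" "V0 \<subseteq> K"
      using compact_nbhd[of UNIV 0] by auto
    define V where "V = A \<inter> (\<lambda>x. x + n) -` B \<inter> V0"
    have V: "open V" "0 \<in> V" "V \<subseteq> K" "\<And>t. t \<in> V \<Longrightarrow> t + n \<notin> V"
      using AB V0 open_right_shift[OF AB(2), of n] by (auto simp: V_def)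
    have VL: "(\<lambda>t. indicator V t) \<in> Lp \<mu> p \<omega>"
      using V by (intro indicator_in_Lp[OF V0(2)]) auto
    obtain s where s: "AE t in \<mu>. (\<lambda>k. f (- s k + t)) \<longlonglongrightarrow> indicator V t"
      by (rule dense_orbit_AE_limit[OF dense VL])
    have "AE t in \<mu>. f (- s k + (t + n)) = f (- s k + t)" for k
      using AE_left_shift[OF W(3)[OF n], of "- s k"] by (simp add: add.assoc)
    then have inv: "AE t in \<mu>. \<forall>k. f (- s k + (t + n)) = f (- s k + t)"
      by (simp add: AE_all_countable)
    have "AE t in \<mu>. \<not> t \<in> V"
      using s AE_right_shift[OF s, of n] inv
    proof eventually_elim
      case (elim t)
      then have "indicator V (t + n) = (indicator V t :: complex)"
        using LIMSEQ_unique by fastforce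
      then show ?case using V(4)[of t] by auto
    qed
    from not_AE_avoiding_open[OF this V(1,2)] show False by blast
  qed
  then have "(\<Inter>i. W i) = {0}" using W(2) by blast
  then show ?thesis
  proof (rule second_countable_topological_group[OF R W(1,2)])
    fix U :: "'a set" assume U: "open U" "0 \<in> U"
    show "\<exists>V L. open V \<and> compact L \<and> 0 \<in> V \<and> V \<subseteq> L \<and> L \<subseteq> U"
      by (rule compact_nbhd[OF U]) blast
  qed
qed

text \<open>
On a compact group the constants 0 and 1 belong to the weighted space and \<open>\<mu>\<close> is finite. The integral
of \<open>min 1 (cmod (f t))\<close> is the same for all left translates of \<open>f\<close>; passing to the two limits, it would be both
0 and the total mass.
\<close>

theorem dense_vector_imp_not_compact:
  assumes dense: "dense_vector \<mu> p \<omega> S f"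
  shows "\<not> compact (UNIV :: 'a set)"
proof
  assume comp: "compact (UNIV :: 'a set)"
  have [measurable]: "f \<in> borel_measurable \<mu>" using dense by (simp add: dense_vector_def in_Lp_iff)
  define \<Phi> where "\<Phi> = (\<integral>\<^sup>+t. ennreal (min 1 (cmod (f t))) \<partial>\<mu>)"
  have "\<Phi> = ennreal (min 1 (cmod z)) * emeasure \<mu> UNIV" if z: "(\<lambda>t. z) \<in> Lp \<mu> p \<omega>" for z
  proof -
    obtain s where s: "AE t in \<mu>. (\<lambda>k. f (- s k + t)) \<longlonglongrightarrow> z"
      by (rule dense_orbit_AE_limit[OF dense z])
    have "(\<lambda>k. \<integral>\<^sup>+t. ennreal (min 1 (cmod (f (- s k + t)))) \<partial>\<mu>)
        \<longlonglongrightarrow> (\<integral>\<^sup>+t. ennreal (min 1 (cmod z)) \<partial>\<mu>)"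
    proof (rule nn_integral_dominated_convergence[where w = "\<lambda>t. 1"])
      show "AE t in \<mu>. (\<lambda>k. ennreal (min 1 (cmod (f (- s k + t))))) \<longlonglongrightarrow> ennreal (min 1 (cmod z))"
        using s by eventually_elim (intro tendsto_intros)
      show "(\<integral>\<^sup>+t. 1 \<partial>\<mu>) < \<infinity>" using emeasure_compact[OF comp] by simp
    qed auto
    moreover have "(\<integral>\<^sup>+t. ennreal (min 1 (cmod (f (- s k + t)))) \<partial>\<mu>) = \<Phi>" for k
      unfolding \<Phi>_def using nn_integral_left_shift[of "\<lambda>t. ennreal (min 1 (cmod (f t)))" "- s k"] by simp
    ultimately show ?thesis using LIMSEQ_unique[OF tendsto_const] by (simp add: LIMSEQ_const_iff)
  qed
  from this[of 0] this[of 1] have "emeasure \<mu> UNIV = 0"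
    using indicator_in_Lp[OF comp, of "{}"] indicator_in_Lp[OF comp, of UNIV] by simp
  with emeasure_UNIV show False by simp
qed

end

section \<open>The equivalence\<close>

theorem theorem4:
  fixes \<mu> :: "'a::{topological_group_add, t2_space} measure"
  assumes "locally_compact_space (euclidean :: 'a topology)"
    and "left_haar_measure \<mu>"
  shows "(\<not> compact (UNIV :: 'a set) \<and> second_countable (euclidean :: 'a topology) \<longleftrightarrow>
            \<not> compact (UNIV :: 'a set) \<and> dense_for_all_sets_all_p \<mu>) \<and>
         (\<not> compact (UNIV :: 'a set) \<and> second_countable (euclidean :: 'a topology) \<longleftrightarrow>
            \<not> compact (UNIV :: 'a set) \<and> dense_for_all_sets_some_p \<mu>) \<and>
         (\<not> compact (UNIV :: 'a set) \<and> second_countable (euclidean :: 'a topology) \<longleftrightarrow>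
            dense_for_group_all_p \<mu>) \<and>
         (\<not> compact (UNIV :: 'a set) \<and> second_countable (euclidean :: 'a topology) \<longleftrightarrow>
            dense_for_group_some_p \<mu>)"
proof -
  interpret haar \<mu> by unfold_locales (fact assms)+
  let ?nc = "\<not> compact (UNIV :: 'a set)" and ?sc = "second_countable (euclidean :: 'a topology)"
  have forward: "dense_for_all_sets_all_p \<mu> \<and> dense_for_group_all_p \<mu>" if "?nc" "?sc"
  proof -
    obtain len :: "'a \<Rightarrow> nat" where "proper_length len"
      using ex_proper_length[OF \<open>?sc\<close>] by metis
    then interpret haar_length \<mu> len by (intro haar_length.intro haar_axioms)
    have all: "weight \<mu> p wt \<and> admissible \<mu> p S wt \<and> all_translations_bounded \<mu> p wt \<and>
        (\<exists>f. dense_vector \<mu> p wt S f)" if "1 \<le> p" "\<not> compact (closure S)" for p S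
      using that weight_wt admissible_wt all_translations_bounded_wt
        ex_dense_vector[OF \<open>?sc\<close>] unbounded_len by blast
    moreover have "\<not> compact (closure (UNIV :: 'a set))" using \<open>?nc\<close> by simp
    ultimately show ?thesis
      unfolding dense_for_all_sets_all_p_def dense_for_group_all_p_def by blast
  qed
  have converse: "?nc \<and> ?sc" if "1 \<le> p" "weight \<mu> p \<omega>" "dense_vector \<mu> p \<omega> UNIV f" for p \<omega> f
  proof -
    interpret weighted_haar \<mu> p \<omega> by unfold_locales (fact that)+
    show ?thesis
      using dense_vector_imp_second_countable dense_vector_imp_not_compact that(3) by blast
  qed
  have sets: "?sc" if "?nc" "dense_for_all_sets_some_p \<mu>"
  proof -
    have "\<not> compact (closure (UNIV :: 'a set))" using \<open>?nc\<close> by simp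
    then show ?thesis
      using that(2) converse unfolding dense_for_all_sets_some_p_def by blast
  qed
  have group: "?nc \<and> ?sc" if "dense_for_group_some_p \<mu>"
    using that converse unfolding dense_for_group_some_p_def by blast
  have weaken: "dense_for_all_sets_all_p \<mu> \<Longrightarrow> dense_for_all_sets_some_p \<mu>"
    "dense_for_group_all_p \<mu> \<Longrightarrow> dense_for_group_some_p \<mu>"
    unfolding dense_for_all_sets_all_p_def dense_for_all_sets_some_p_def
      dense_for_group_all_p_def dense_for_group_some_p_def
    by (meson order_refl)+
  show ?thesis using forward sets group weaken by blast
qed

end
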